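(* Let $Y(\mathbb{R}^n)$ be a translation-invariant Banach function space and let $w$ be a continuous function with $w(x)>0$ for all $x\in\mathbb{R}^n$. Then $Y(\mathbb{R}^n,w)$ has the bounded $L^2$-approximation property.
   Context: Banach function spaces: let $\mathfrak{M}^+(\mathbb{R}^n)$ be the set of measurable functions with values in $[0,\infty]$. A Banach function norm $\rho:\mathfrak{M}^+\to[0,\infty]$ satisfies, for all $f,g,f_j\in\mathfrak{M}^+$, $a\ge0$, measurable $E$: (A1) $\rho(f)=0\iff f=0$ a.e., $\rho(af)=a\rho(f)$, $\rho(f+g)\le\rho(f)+\rho(g)$; (A2) $0\le g\le f$ a.e. implies $\rho(g)\le\rho(f)$; (A3) $0\le f_j\uparrow f$ a.e. implies $\rho(f_j)\uparrow\rho(f)$; (A4) $|E|<\infty$ implies $\rho(\chi_E)<\infty$; (A5) $|E|<\infty$ implies $\int_Ef\le C_E\rho(f)$ with $C_E$ independent of $f$. $Y(\mathbb{R}^n)$ is the set of measurable complex $f$ with $\rho(|f|)<\infty$, $\|f\|_Y=\rho(|f|)$; it is translation-invariant if $\|u(\cdot-y)\|_Y=\|u\|_Y$ for all $y$, $u\in Y$. $Y(\mathbb{R}^n,w)=\{f: fw\in Y\}$ with norm $\|fw\|_Y$. Bounded $L^2$-approximation property of a Banach function space $X$: for every $u\in L^2(\mathbb{R}^n)\cap X$ there is a sequence $u_j\in C_0^\infty(\mathbb{R}^n)$ with $\|u-u_j\|_{L^2}\to0$ and $\limsup_j\|u_j\|_X\le\|u\|_X$. *)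

theory Defs
  imports "HOL-Analysis.Analysis" "HOL-Library.Liminf_Limsup"
begin

definition banach_function_norm :: "(('a::euclidean_space \<Rightarrow> ennreal) \<Rightarrow> ennreal) \<Rightarrow> bool" where
  "banach_function_norm \<rho> \<longleftrightarrow>
    \<comment> \<open>(A1)\<close>
    (\<forall>f \<in> borel_measurable lebesgue. \<rho> f = 0 \<longleftrightarrow> (AE x in lebesgue. f x = 0)) \<and>
    (\<forall>f \<in> borel_measurable lebesgue. \<forall>a::real. a \<ge> 0 \<longrightarrow>
        \<rho> (\<lambda>x. ennreal a * f x) = ennreal a * \<rho> f) \<and>
    (\<forall>f \<in> borel_measurable lebesgue. \<forall>g \<in> borel_measurable lebesgue.
        \<rho> (\<lambda>x. f x + g x) \<le> \<rho> f + \<rho> g) \<and>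
    \<comment> \<open>(A2)\<close>
    (\<forall>f \<in> borel_measurable lebesgue. \<forall>g \<in> borel_measurable lebesgue.
        (AE x in lebesgue. g x \<le> f x) \<longrightarrow> \<rho> g \<le> \<rho> f) \<and>
    \<comment> \<open>(A3)\<close>
    (\<forall>F f. (\<forall>j. F j \<in> borel_measurable lebesgue) \<longrightarrow> f \<in> borel_measurable lebesgue \<longrightarrow>
        (AE x in lebesgue. incseq (\<lambda>j. F j x) \<and> (\<lambda>j. F j x) \<longlonglongrightarrow> f x) \<longrightarrow>
        incseq (\<lambda>j. \<rho> (F j)) \<and> (\<lambda>j. \<rho> (F j)) \<longlonglongrightarrow> \<rho> f) \<and>
    \<comment> \<open>(A4)\<close>
    (\<forall>E \<in> sets lebesgue. emeasure lebesgue E < \<infinity> \<longrightarrow> \<rho> (indicator E) < \<infinity>) \<and>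
    \<comment> \<open>(A5)\<close>
    (\<forall>E \<in> sets lebesgue. emeasure lebesgue E < \<infinity> \<longrightarrow>
        (\<exists>C::ennreal. C < \<infinity> \<and> (\<forall>f \<in> borel_measurable lebesgue.
            (\<integral>\<^sup>+ x \<in> E. f x \<partial>lebesgue) \<le> C * \<rho> f)))"

definition bfs_space :: "(('a::euclidean_space \<Rightarrow> ennreal) \<Rightarrow> ennreal) \<Rightarrow> ('a \<Rightarrow> complex) set" where
  "bfs_space \<rho> = {f. f \<in> borel_measurable lebesgue \<and> \<rho> (\<lambda>x. ennreal (cmod (f x))) < \<infinity>}"

definition bfs_norm :: "(('a::euclidean_space \<Rightarrow> ennreal) \<Rightarrow> ennreal) \<Rightarrow> ('a \<Rightarrow> complex) \<Rightarrow> ennreal" where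
  "bfs_norm \<rho> f = \<rho> (\<lambda>x. ennreal (cmod (f x)))"

definition translation_invariant :: "(('a::euclidean_space \<Rightarrow> ennreal) \<Rightarrow> ennreal) \<Rightarrow> bool" where
  "translation_invariant \<rho> \<longleftrightarrow>
     (\<forall>u \<in> bfs_space \<rho>. \<forall>y. bfs_norm \<rho> (\<lambda>x. u (x - y)) = bfs_norm \<rho> u)"

definition weighted_space :: "(('a::euclidean_space \<Rightarrow> ennreal) \<Rightarrow> ennreal) \<Rightarrow> ('a \<Rightarrow> real) \<Rightarrow> ('a \<Rightarrow> complex) set" where
  "weighted_space \<rho> w = {f. (\<lambda>x. f x * complex_of_real (w x)) \<in> bfs_space \<rho>}"

definition weighted_norm :: "(('a::euclidean_space \<Rightarrow> ennreal) \<Rightarrow> ennreal) \<Rightarrow> ('a \<Rightarrow> real) \<Rightarrow> ('a \<Rightarrow> complex) \<Rightarrow> ennreal" where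
  "weighted_norm \<rho> w f = bfs_norm \<rho> (\<lambda>x. f x * complex_of_real (w x))"

coinductive smooth_fun :: "('a::euclidean_space \<Rightarrow> complex) \<Rightarrow> bool" where
  "(\<forall>x. f differentiable (at x)) \<Longrightarrow> (\<forall>v. smooth_fun (\<lambda>x. frechet_derivative f (at x) v))
   \<Longrightarrow> smooth_fun f"

definition C0_infinity :: "('a::euclidean_space \<Rightarrow> complex) set" where
  "C0_infinity = {f. smooth_fun f \<and> compact (closure {x. f x \<noteq> 0})}"

definition L2_space :: "('a::euclidean_space \<Rightarrow> complex) set" where
  "L2_space = {u. u \<in> borel_measurable lebesgue \<and> (\<integral>\<^sup>+ x. ennreal (cmod (u x)) ^ 2 \<partial>lebesgue) < \<infinity>}"

text \<open>Bounded L2-approximation property of a space X with norm N (N u = \<infinity> outside X).\<close>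
definition bounded_L2_approx :: "('a::euclidean_space \<Rightarrow> complex) set \<Rightarrow> (('a \<Rightarrow> complex) \<Rightarrow> ennreal) \<Rightarrow> bool" where
  "bounded_L2_approx X N \<longleftrightarrow>
     (\<forall>u \<in> L2_space \<inter> X. \<exists>U :: nat \<Rightarrow> 'a \<Rightarrow> complex.
        (\<forall>j. U j \<in> C0_infinity) \<and>
        (\<lambda>j. \<integral>\<^sup>+ x. ennreal (cmod (u x - U j x)) ^ 2 \<partial>lebesgue) \<longlonglongrightarrow> 0 \<and>
        limsup (\<lambda>j. N (U j)) \<le> N u)"

end

theory Submission
  imports Defs
begin

text \<open>Truncate u to a bounded function with bounded support and convolve it with a smooth bump
  of small support. On a compact set w is uniformly continuous and bounded below, so the weight can be
  moved inside the convolution at the cost of a factor 1 + e; translation invariance and Minkowski's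
  inequality then bound the weighted norm of the convolution.\<close>

text \<open>Translation need not be continuous in the norm of \<open>Y\<close> (it is not for the
  supremum norm), so mollification is only asked to satisfy a norm bound in \<open>Y\<close>; actual
  convergence takes place in L2. Since the \<open>limsup\<close> bound has constant 1, the weight
  must be nearly constant at the scale of the bump, hence the factor \<open>1 + e\<close> and not
  merely some constant.

  The obstacle is Minkowski's inequality, because \<open>\<rho>\<close> is not an integral. For
  finite convex combinations of translates it follows from (A1) and invariance, and (A3) gives a
  Fatou property for limits almost everywhere. So it suffices to reach the convolution as such a
  limit. Continuity of translation in L1 provides it: convergence in L1, then a subsequence. This is
  one reason for truncating; the other is that a bound \<open>B\<close> on both functions gives
  \<open>|U - v|^2 \<le> 2 * B * |U - v|\<close>, so that closeness in L1 becomes closeness in L2.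

  Smoothness is a coinductive predicate. Each smoothness proof therefore exhibits a class of
  differentiable functions that is closed under directional derivatives.\<close>

subsection \<open>Smooth functions\<close>

text \<open>The classical flat function exp(-1/t), extended by 0 to t \<le> 0, is the case
  \<open>k = 0\<close>. The factor \<open>inverse t ^ k\<close> is carried along because
  differentiation produces it.\<close>

definition flat :: "nat \<Rightarrow> real \<Rightarrow> real" where
  "flat k t = (if t \<le> 0 then 0 else inverse t ^ k / exp (inverse t))"

lemma flat_nonneg: "flat k t \<ge> 0"
  by (simp add: flat_def)

lemma flat_tendsto_0: "(flat k \<longlongrightarrow> 0) (at 0)"
proof (rule filterlim_split_at)
  have "eventually (\<lambda>t. flat k t = 0) (at_left 0)"
    by (auto simp: flat_def eventually_at_filter)
  then show "(flat k \<longlongrightarrow> 0) (at_left 0)"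
    by (rule tendsto_eventually)
  have "((\<lambda>t. inverse t ^ k / exp (inverse t)) \<longlongrightarrow> 0) (at_right (0::real))"
    by (rule filterlim_compose[OF tendsto_power_div_exp_0 filterlim_inverse_at_top_right])
  moreover have "eventually (\<lambda>t. inverse t ^ k / exp (inverse t) = flat k t) (at_right (0::real))"
    by (auto simp: flat_def eventually_at_filter)
  ultimately show "(flat k \<longlongrightarrow> 0) (at_right 0)"
    by (rule Lim_transform_eventually)
qed

text \<open>The derivative is again a linear combination of members of the family; this is what
  later closes the algebra under differentiation.\<close>

lemma flat_has_field_derivative:
  "(flat k has_field_derivative flat (k + 2) t - real k * flat (k + 1) t) (at t)"
proof -
  consider "t < 0" | "t = 0" | "t > 0" by linarith
  then show ?thesis
  proof cases
    case 1
    have "((\<lambda>_. 0) has_field_derivative 0) (at t)" by simp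
    then have "(flat k has_field_derivative 0) (at t)"
      by (rule has_field_derivative_transform_within_open[where S = "{..<0}"])
         (use 1 in \<open>auto simp: flat_def\<close>)
    then show ?thesis using 1 by (simp add: flat_def)
  next
    case 2
    \<comment> \<open>At 0 the difference quotient \<open>flat k h / h\<close> is
      \<open>flat (Suc k) h\<close>, whose limit is already known.\<close>
    have "((\<lambda>h. flat (Suc k) h) \<longlongrightarrow> 0) (at 0)" by (rule flat_tendsto_0)
    then have "((\<lambda>h. (flat k (0 + h) - flat k 0) / h) \<longlongrightarrow> 0) (at 0)"
      by (rule Lim_transform_eventually)
         (auto simp: flat_def eventually_at_filter field_simps)
    then show ?thesis using 2 by (simp add: DERIV_def flat_def)
  next
    case 3
    \<comment> \<open>For positive \<open>t\<close> the function is \<open>s ^ k * exp (- s)\<close>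
      at \<open>s = inverse t\<close>, so the chain rule applies.\<close>
    have "((\<lambda>s. s ^ k * exp (- s)) has_field_derivative
        real k * inverse t ^ (k - 1) * exp (- inverse t) - inverse t ^ k * exp (- inverse t)) (at (inverse t))"
      by (auto intro!: derivative_eq_intros)
    from DERIV_chain2[OF this DERIV_inverse] 3
    have "((\<lambda>t. inverse t ^ k / exp (inverse t)) has_field_derivative
        (real k * inverse t ^ (k - 1) * exp (- inverse t) - inverse t ^ k * exp (- inverse t)) *
        - (inverse t ^ Suc (Suc 0))) (at t)"
      by (simp add: exp_minus divide_inverse)
    moreover have "(real k * inverse t ^ (k - 1) * exp (- inverse t) - inverse t ^ k * exp (- inverse t)) *
        - (inverse t ^ Suc (Suc 0)) = flat (k + 2) t - real k * flat (k + 1) t"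
      \<comment> \<open>For \<open>k = 0\<close> the exponent \<open>k - 1\<close> is truncated to
        0, which is harmless because of the factor \<open>real k\<close>.\<close>
      using 3 by (cases k) (auto simp: flat_def exp_minus field_simps)
    ultimately have "((\<lambda>t. inverse t ^ k / exp (inverse t)) has_field_derivative
        flat (k + 2) t - real k * flat (k + 1) t) (at t)"
      by simp
    then show ?thesis
      by (rule has_field_derivative_transform_within_open[where S = "{0<..}"])
         (use 3 in \<open>auto simp: flat_def\<close>)
  qed
qed

text \<open>The algebra generated by the functions below is closed under directional derivatives, so
  all of its members are smooth.\<close>

inductive_set bump_algebra :: "real \<Rightarrow> ('a::euclidean_space \<Rightarrow> complex) set" for a :: real where
  const: "(\<lambda>x. c) \<in> bump_algebra a"
| linear: "(\<lambda>x. of_real (x \<bullet> v)) \<in> bump_algebra a"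
| flat: "(\<lambda>x. of_real (flat k (a - x \<bullet> x))) \<in> bump_algebra a"
| add: "f \<in> bump_algebra a \<Longrightarrow> g \<in> bump_algebra a \<Longrightarrow> (\<lambda>x. f x + g x) \<in> bump_algebra a"
| mult: "f \<in> bump_algebra a \<Longrightarrow> g \<in> bump_algebra a \<Longrightarrow> (\<lambda>x. f x * g x) \<in> bump_algebra a"

text \<open>The proof shows where the generators come from: the chain rule for
  \<open>flat k (a - x \<bullet> x)\<close> brings in the linear functions and higher
  \<open>k\<close>, and linear functions have constant derivatives. The direction \<open>v\<close>
  is fixed in the second conjunct because \<open>smooth_fun\<close> iterates directional
  derivatives.\<close>

lemma bump_algebra_has_derivative:
  fixes f :: "'a::euclidean_space \<Rightarrow> complex"
  assumes "f \<in> bump_algebra a"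
  shows "\<exists>D. (\<forall>x. (f has_derivative D x) (at x)) \<and> (\<forall>v. (\<lambda>x. D x v) \<in> bump_algebra a)"
  using assms
proof induction
  case (const c)
  show ?case
    by (intro exI[of _ "\<lambda>x v. 0"]) (auto intro: bump_algebra.const)
next
  case (linear w)
  show ?case
    by (intro exI[of _ "\<lambda>x v. of_real (v \<bullet> w)"])
       (auto intro!: bump_algebra.const derivative_eq_intros)
next
  case (flat k)
  define d where "d x = flat (k + 2) (a - x \<bullet> x) - real k * flat (k + 1) (a - x \<bullet> x)" for x :: 'a
  have "((\<lambda>x. complex_of_real (flat k (a - x \<bullet> x))) has_derivative
      (\<lambda>v. of_real (d x) * (- 2 * of_real (x \<bullet> v)))) (at x)" for x :: 'a
  proof -
    have "((\<lambda>x. a - x \<bullet> x) has_derivative (\<lambda>v. - 2 * (x \<bullet> v))) (at x)"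
      by (auto intro!: derivative_eq_intros simp: inner_commute)
    from has_derivative_compose[OF this flat_has_field_derivative[unfolded has_field_derivative_def]]
    have "((\<lambda>x. flat k (a - x \<bullet> x)) has_derivative (\<lambda>v. d x * (- 2 * (x \<bullet> v)))) (at x)"
      by (simp add: d_def)
    from has_derivative_of_real[OF this, where 'a = complex] show ?thesis by simp
  qed
  moreover have "(\<lambda>x. of_real (d x) * (- 2 * of_real (x \<bullet> v))) \<in> bump_algebra a" for v :: 'a
  proof -
    have "(\<lambda>x::'a. (of_real (flat (k + 2) (a - x \<bullet> x)) + (- of_real (real k)) * of_real (flat (k + 1) (a - x \<bullet> x)))
        * (- 2 * of_real (x \<bullet> v))) \<in> bump_algebra a"
      by (intro bump_algebra.intros)
    then show ?thesis by (simp add: d_def)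
  qed
  ultimately show ?case
    by (intro exI[of _ "\<lambda>x v. of_real (d x) * (- 2 * of_real (x \<bullet> v))"]) simp
next
  case (add f g)
  then obtain D E where D: "\<forall>x. (f has_derivative D x) (at x)" "\<forall>v. (\<lambda>x. D x v) \<in> bump_algebra a"
    and E: "\<forall>x. (g has_derivative E x) (at x)" "\<forall>v. (\<lambda>x. E x v) \<in> bump_algebra a"
    by blast
  then show ?case
    by (intro exI[of _ "\<lambda>x v. D x v + E x v"])
       (auto intro!: has_derivative_add bump_algebra.add)
next
  case (mult f g)
  then obtain D E where D: "\<forall>x. (f has_derivative D x) (at x)" "\<forall>v. (\<lambda>x. D x v) \<in> bump_algebra a"
    and E: "\<forall>x. (g has_derivative E x) (at x)" "\<forall>v. (\<lambda>x. E x v) \<in> bump_algebra a"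
    by blast
  with mult.hyps show ?case
    by (intro exI[of _ "\<lambda>x v. f x * E x v + D x v * g x"])
       (auto intro!: has_derivative_mult bump_algebra.add bump_algebra.mult)
qed

text \<open>Membership in the algebra is the coinduction invariant.\<close>

lemma bump_algebra_smooth:
  fixes f :: "'a::euclidean_space \<Rightarrow> complex"
  assumes "f \<in> bump_algebra a"
  shows "smooth_fun f"
  using assms
proof (coinduction arbitrary: f)
  case (smooth_fun f)
  then obtain D where D: "\<And>x. (f has_derivative D x) (at x)" "\<And>v. (\<lambda>x. D x v) \<in> bump_algebra a"
    using bump_algebra_has_derivative by blast
  have "frechet_derivative f (at x) = D x" for x
    using frechet_derivative_at[OF D(1)] by simp
  with D show ?case
    by (auto simp: differentiable_def)
qed

lemma smooth_fun_differentiable: "smooth_fun f \<Longrightarrow> f differentiable (at x)"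
  by (auto elim: smooth_fun.cases)

lemma smooth_fun_frechet_derivative:
  "smooth_fun f \<Longrightarrow> smooth_fun (\<lambda>x. frechet_derivative f (at x) v)"
  by (auto elim: smooth_fun.cases)

lemma smooth_fun_continuous_on: "smooth_fun f \<Longrightarrow> continuous_on S f"
  by (meson continuous_at_imp_continuous_on differentiable_imp_continuous_within smooth_fun_differentiable)

section \<open>Differentiation of convolutions\<close>

text \<open>One \<open>d\<close> works for all base points in a ball, so the first-order error can
  later be integrated. Each directional derivative is continuous, hence uniformly continuous on
  compact sets; the finitely many basis directions control the operator norm, and the mean value
  inequality does the rest.\<close>

lemma smooth_fun_uniformly_differentiable:
  fixes f :: "'a::euclidean_space \<Rightarrow> complex"
  assumes f: "smooth_fun f" and "e > 0"
  obtains d where "d > 0" "\<And>z h. z \<in> cball 0 R \<Longrightarrow> norm h < d \<Longrightarrow>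
    norm (f (z + h) - f z - frechet_derivative f (at z) h) \<le> e * norm h"
proof -
  let ?D = "\<lambda>x. frechet_derivative f (at x)"
  \<comment> \<open>The extra 1, together with \<open>d \<le> 1\<close>, keeps
    \<open>ball z d\<close> inside \<open>?K\<close> for every \<open>z\<close> in the ball of
    radius \<open>R\<close>.\<close>
  let ?K = "cball (0::'a) (R + 1)"
  have lin: "(f has_derivative ?D x) (at x)" for x
    using smooth_fun_differentiable[OF f] frechet_derivative_works by blast
  \<comment> \<open>The operator norm is estimated by a sum of one term per basis vector, each at
    most \<open>norm h * e'\<close>.\<close>
  define e' where "e' = e / DIM('a)"
  have e': "e' > 0" using \<open>e > 0\<close> by (simp add: e'_def)
  have "\<exists>d>0. \<forall>x\<in>?K. \<forall>y\<in>?K. dist y x < d \<longrightarrow> dist (?D y b) (?D x b) < e'" for b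
    using compact_uniformly_continuous[OF smooth_fun_continuous_on[OF smooth_fun_frechet_derivative[OF f, of b]] compact_cball[of 0 "R + 1"]]
      e' unfolding uniformly_continuous_on_def by blast
  then obtain \<delta> where \<delta>: "\<And>b. \<delta> b > 0"
      "\<And>b x y. x \<in> ?K \<Longrightarrow> y \<in> ?K \<Longrightarrow> dist y x < \<delta> b \<Longrightarrow> dist (?D y b) (?D x b) < e'"
    by metis
  define d where "d = min 1 (Min (\<delta> ` (Basis::'a set)))"
  have d: "d > 0" "d \<le> 1" using \<delta>(1) by (auto simp: d_def)
  have d\<delta>: "d \<le> \<delta> b" if "b \<in> Basis" for b using that by (auto simp: d_def intro: min.coboundedI2)
  have onorm: "onorm (\<lambda>h. ?D y h - ?D x h) \<le> e"
    if "x \<in> ?K" "y \<in> ?K" "dist y x < d" for x y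
  proof (rule onorm_le)
    fix h :: 'a
    have lx: "linear (?D x)" "linear (?D y)" using lin has_derivative_linear by blast+
    have "linear (\<lambda>h. ?D y h - ?D x h)" by (rule linear_compose_sub[OF lx(2) lx(1)])
    from linear_sum[OF this, of "\<lambda>b. (h \<bullet> b) *\<^sub>R b" Basis]
    have "?D y h - ?D x h = (\<Sum>b\<in>Basis. (h \<bullet> b) *\<^sub>R (?D y b - ?D x b))"
      by (simp add: euclidean_representation linear_scale[OF lx(1)] linear_scale[OF lx(2)] scaleR_diff_right)
    also have "norm \<dots> \<le> (\<Sum>b\<in>(Basis::'a set). norm h * e')"
    proof (rule sum_norm_le)
      fix b :: 'a assume b: "b \<in> Basis"
      have "dist (?D y b) (?D x b) < e'"
        using \<delta>(2)[OF that(1,2), of b] that(3) d\<delta>[OF b] by linarith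
      then show "norm ((h \<bullet> b) *\<^sub>R (?D y b - ?D x b)) \<le> norm h * e'"
        using Basis_le_norm[OF b, of h] by (auto simp: dist_norm intro!: mult_mono)
    qed
    also have "\<dots> = e * norm h" by (simp add: e'_def)
    finally show "norm (?D y h - ?D x h) \<le> e * norm h" .
  qed
  show thesis
  proof (rule that[OF d(1)])
    fix z h :: 'a assume z: "z \<in> cball 0 R" and h: "norm h < d"
    let ?S = "ball z d"
    have sub: "?S \<subseteq> ?K"
    proof
      fix x assume x: "x \<in> ?S"
      have "norm x \<le> norm z + norm (x - z)" using norm_triangle_sub[of x z] by simp
      with x z d(2) show "x \<in> ?K" by (simp add: dist_norm norm_minus_commute)
    qed
    have "norm (f (z + h) - f z - ?D z (z + h - z)) \<le> norm (z + h - z) * e"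
    proof (rule differentiable_bound_linearization[where S = ?S])
      fix t :: real assume t: "t \<in> {0..1}"
      have "norm (t *\<^sub>R h) \<le> norm h" using t by (simp add: mult_left_le_one_le)
      with h show "z + t *\<^sub>R (z + h - z) \<in> ?S" by (simp add: dist_norm)
    next
      show "z \<in> ?S" using d by simp
    next
      fix x assume "x \<in> ?S"
      then show "(f has_derivative ?D x) (at x within ?S)" by (meson lin has_derivative_at_withinI)
    next
      fix x assume "x \<in> ?S"
      then show "onorm (?D x - ?D z) \<le> e"
        unfolding fun_diff_def using onorm[of z x] subsetD[OF sub, of z] subsetD[OF sub, of x] d
        by (auto simp: dist_commute)
    qed
    then show "norm (f (z + h) - f z - ?D z h) \<le> e * norm h" by (simp add: mult.commute)
  qed
qed

lemma integrable_mult_bounded_support: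
  fixes u :: "'a::euclidean_space \<Rightarrow> complex"
  assumes u: "integrable lborel u" and u0: "\<And>y. norm y > R \<Longrightarrow> u y = 0"
    and g: "continuous_on UNIV g"
  shows "integrable lborel (\<lambda>y. u y * g y)"
proof -
  have "bounded (g ` cball 0 R)"
    by (intro compact_imp_bounded compact_continuous_image continuous_on_subset[OF g]) auto
  then obtain B where B: "\<And>y. y \<in> cball 0 R \<Longrightarrow> norm (g y) \<le> B" by (metis bounded_iff imageI)
  have [measurable]: "g \<in> borel_measurable borel" using g by (rule borel_measurable_continuous_onI)
  have [measurable]: "u \<in> borel_measurable borel" using u by auto
  show ?thesis
  proof (rule Bochner_Integration.integrable_bound[where f = "\<lambda>y. u y * of_real B"])
    show "AE y in lborel. norm (u y * g y) \<le> norm (u y * of_real B)"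
    proof (rule AE_I2)
      fix y show "norm (u y * g y) \<le> norm (u y * of_real B)"
      proof (cases "norm y > R")
        case False
        then have "norm (g y) \<le> \<bar>B\<bar>" using B[of y] by fastforce
        then show ?thesis by (simp add: norm_mult mult_left_mono)
      qed (simp add: u0)
    qed
  qed (use u in auto)
qed

text \<open>All derivatives fall on \<open>f\<close>: the derivative of the convolution in direction
  \<open>v\<close> is the convolution of \<open>u\<close> with the derivative of \<open>f\<close> in
  direction \<open>v\<close>, which has the same form. Hence the coinduction varies \<open>f\<close>
  and keeps \<open>u\<close> fixed.\<close>

lemma smooth_fun_convolution:
  fixes f u :: "'a::euclidean_space \<Rightarrow> complex"
  assumes "smooth_fun f"
    and u: "integrable lborel u" and u0: "\<And>y. norm y > R \<Longrightarrow> u y = 0"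
  shows "smooth_fun (\<lambda>x. \<integral>y. u y * f (x - y) \<partial>lborel)"
  using assms(1)
proof (coinduction arbitrary: f)
  case (smooth_fun f)
  let ?D = "\<lambda>x. frechet_derivative f (at x)"
  let ?F = "\<lambda>f x. \<integral>y. u y * f (x - y) \<partial>lborel"
  have int: "integrable lborel (\<lambda>y. u y * g (x - y))" if "smooth_fun g" for g x
    by (intro integrable_mult_bounded_support[OF u u0] continuous_on_compose2[OF smooth_fun_continuous_on[OF that]]
        continuous_intros) auto
  have lin: "bounded_linear (?D x)" for x
    using smooth_fun_differentiable[OF smooth_fun] frechet_derivative_works has_derivative_bounded_linear by blast
  have intD: "integrable lborel (\<lambda>y. u y * ?D (x - y) v)" for x v
    by (rule int[OF smooth_fun_frechet_derivative[OF smooth_fun, of v]])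
  have "(?F f has_derivative (\<lambda>v. ?F (\<lambda>z. ?D z v) x)) (at x)" for x
    unfolding has_derivative_within_alt
  proof (intro conjI allI impI)
    have "linear (\<lambda>v. ?F (\<lambda>z. ?D z v) x)"
      by (rule linearI)
         (auto simp: linear_add[OF bounded_linear.linear[OF lin]] linear_scale[OF bounded_linear.linear[OF lin]]
           distrib_left intD)
    then show "bounded_linear (\<lambda>v. ?F (\<lambda>z. ?D z v) x)"
      by (simp add: linear_conv_bounded_linear)
    fix e :: real assume "e > 0"
    define I where "I = (\<integral>y. norm (u y) \<partial>lborel)"
    have I: "I \<ge> 0" by (simp add: I_def)
    \<comment> \<open>The error per unit of \<open>u\<close> is integrated against
      \<open>norm (u t)\<close>, which multiplies it by \<open>I\<close>; the added 1 avoids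
      division by zero.\<close>
    define e' where "e' = e / (I + 1)"
    have e': "e' > 0" "e' * I \<le> e" using \<open>e > 0\<close> I by (auto simp: e'_def field_simps)
    \<comment> \<open>The ball of radius \<open>norm x + R\<close> contains every point
      \<open>x - t\<close> at which \<open>u t\<close> can be nonzero.\<close>
    obtain d where d: "d > 0" "\<And>z h. z \<in> cball 0 (norm x + R) \<Longrightarrow> norm h < d \<Longrightarrow>
        norm (f (z + h) - f z - ?D z h) \<le> e' * norm h"
      by (rule smooth_fun_uniformly_differentiable[OF smooth_fun e'(1), where R = "norm x + R"]) blast
    show "\<exists>d>0. \<forall>y\<in>UNIV. norm (y - x) < d \<longrightarrow>
        norm (?F f y - ?F f x - ?F (\<lambda>z. ?D z (y - x)) x) \<le> e * norm (y - x)"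
    proof (intro exI[of _ d] conjI ballI impI d(1))
      fix y assume y: "norm (y - x) < d"
      let ?h = "y - x"
      let ?G = "\<lambda>t. u t * f (y - t) - u t * f (x - t) - u t * ?D (x - t) ?h"
      have "?F f y - ?F f x - ?F (\<lambda>z. ?D z ?h) x = (\<integral>t. ?G t \<partial>lborel)"
        by (simp add: int[OF smooth_fun] intD)
      then have "norm (?F f y - ?F f x - ?F (\<lambda>z. ?D z ?h) x) \<le> (\<integral>t. norm (?G t) \<partial>lborel)"
        using integral_norm_bound[of lborel ?G] by (simp only:)
      also have "\<dots> \<le> (\<integral>t. norm (u t) * (e' * norm ?h) \<partial>lborel)"
      proof (rule integral_mono)
        show "integrable lborel (\<lambda>t. norm (?G t))"
          by (simp add: int[OF smooth_fun] intD)
        show "integrable lborel (\<lambda>t. norm (u t) * (e' * norm ?h))"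
          using u by auto
        fix t
        show "norm (?G t) \<le> norm (u t) * (e' * norm ?h)"
        proof (cases "norm t > R")
          case False
          have "norm (x - t) \<le> norm x + norm t" by (rule norm_triangle_ineq4)
          then have "norm (f (x - t + ?h) - f (x - t) - ?D (x - t) ?h) \<le> e' * norm ?h"
            using False by (intro d(2) y) auto
          moreover have "?G t = u t * (f (x - t + ?h) - f (x - t) - ?D (x - t) ?h)"
            by (simp add: algebra_simps)
          ultimately show ?thesis by (simp add: norm_mult mult_left_mono)
        qed (simp add: u0)
      qed
      also have "\<dots> = (e' * I) * norm ?h" by (simp add: I_def)
      also have "\<dots> \<le> e * norm ?h" using e' by (intro mult_right_mono) auto
      finally show "norm (?F f y - ?F f x - ?F (\<lambda>z. ?D z ?h) x) \<le> e * norm ?h" .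
    qed
  qed
  note D = this
  have "frechet_derivative (?F f) (at x) = (\<lambda>v. ?F (\<lambda>z. ?D z v) x)" for x
    using frechet_derivative_at[OF D] by simp
  with D smooth_fun_frechet_derivative[OF smooth_fun] show ?case
    by (auto simp: differentiable_def)
qed

subsection \<open>Continuity of translation in L1\<close>

lemma lborel_distr_reflect: "distr lborel borel (\<lambda>x. t - x) = (lborel :: 'a::euclidean_space measure)"
  using lborel_affine[of "-1" t] by (simp add: density_1)

lemma lborel_distr_shift: "distr lborel borel (\<lambda>x. x - t) = (lborel :: 'a::euclidean_space measure)"
  using lborel_affine[of 1 "- t"] by (simp add: density_1)

lemma integral_lborel_reflect:
  fixes f :: "'a::euclidean_space \<Rightarrow> 'b::{banach, second_countable_topology}"
  assumes [measurable]: "f \<in> borel_measurable borel"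
  shows "(\<integral>x. f (t - x) \<partial>lborel) = (\<integral>x. f x \<partial>lborel)"
  by (subst (2) lborel_distr_reflect[of t, symmetric]) (simp add: integral_distr)

lemma integral_lborel_shift:
  fixes f :: "'a::euclidean_space \<Rightarrow> 'b::{banach, second_countable_topology}"
  assumes [measurable]: "f \<in> borel_measurable borel"
  shows "(\<integral>x. f (x - t) \<partial>lborel) = (\<integral>x. f x \<partial>lborel)"
  by (subst (2) lborel_distr_shift[of t, symmetric]) (simp add: integral_distr)

lemma nn_integral_lborel_shift:
  fixes f :: "'a::euclidean_space \<Rightarrow> ennreal"
  assumes [measurable]: "f \<in> borel_measurable borel"
  shows "(\<integral>\<^sup>+x. f (x - t) \<partial>lborel) = (\<integral>\<^sup>+x. f x \<partial>lborel)"
  by (subst (2) lborel_distr_shift[of t, symmetric]) (simp add: nn_integral_distr)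

lemma integrable_lborel_shift:
  fixes f :: "'a::euclidean_space \<Rightarrow> 'b::{banach, second_countable_topology}"
  assumes "integrable lborel f"
  shows "integrable lborel (\<lambda>x. f (x - t))"
proof -
  have [measurable]: "f \<in> borel_measurable borel" using assms by auto
  from assms show ?thesis
    by (subst (asm) lborel_distr_shift[of t, symmetric]) (simp add: integrable_distr_eq)
qed

lemma integrable_bounded_support:
  fixes f :: "'a::euclidean_space \<Rightarrow> 'b::{banach, second_countable_topology}"
  assumes "f \<in> borel_measurable borel"
    and "\<And>x. norm (f x) \<le> B" and "\<And>x. norm x > R \<Longrightarrow> f x = 0"
  shows "integrable lborel f"
proof (rule Bochner_Integration.integrable_bound[where f = "\<lambda>x. indicator (cball 0 R) x * B"])
  show "integrable lborel (\<lambda>x. indicator (cball (0::'a) R) x * B)"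
    by (intro integrable_mult_left integrable_real_indicator emeasure_compact_finite) auto
  show "AE x in lborel. norm (f x) \<le> norm (indicator (cball 0 R) x * B)"
  proof (rule AE_I2)
    fix x show "norm (f x) \<le> norm (indicator (cball 0 R) x * B)"
      using assms(2)[of x] assms(3)[of x] by (cases "norm x > R") auto
  qed
qed (use assms in simp)

text \<open>A measurable function is an almost everywhere limit of continuous ones. Clipping these
  to the bound and the support of \<open>g\<close> gives an integrable majorant, so dominated
  convergence turns the limit into one in L1. The same clipping provides the bound and support of
  \<open>c\<close> that translation needs.\<close>

lemma L1_dense_continuous:
  fixes g :: "'a::euclidean_space \<Rightarrow> 'b::euclidean_space"
  assumes g [measurable]: "g \<in> borel_measurable borel"
    and B: "\<And>x. norm (g x) \<le> B" and R: "\<And>x. norm x > R \<Longrightarrow> g x = 0" and "e > 0"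
  obtains c where "continuous_on UNIV c" "\<And>x. norm (c x) \<le> B" "\<And>x. norm x > R + 1 \<Longrightarrow> c x = 0"
    "(\<integral>x. norm (c x - g x) \<partial>lborel) < e"
proof -
  have B0: "B \<ge> 0" using B[of 0] norm_ge_zero order_trans by blast
  have "g measurable_on UNIV"
    by (rule lebesgue_measurable_imp_measurable_on) (auto intro: measurable_completion)
  then obtain N c where N: "negligible N" and c: "\<And>n. continuous_on UNIV (c n)"
    "\<And>x. x \<notin> N \<Longrightarrow> (\<lambda>n. c n x) \<longlonglongrightarrow> g x"
    by (auto simp: measurable_on_def)
  \<comment> \<open>\<open>P\<close> is continuous and fixes the values of \<open>g\<close>, and
    \<theta> is 1 where \<open>g\<close> can be nonzero, so neither changes the limit.\<close>
  define P where "P = closest_point (cball (0::'b) B)"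
  define \<theta> where "\<theta> x = max 0 (min 1 (R + 1 - norm x))" for x :: 'a
  define d where "d n x = \<theta> x *\<^sub>R P (c n x)" for n x
  have cP: "continuous_on UNIV P" unfolding P_def
    by (rule continuous_on_closest_point) (use B0 in auto)
  have P: "norm (P z) \<le> B" for z
    using closest_point_in_set[of "cball (0::'b) B" z] B0 by (simp add: P_def)
  have Pg: "P (g x) = g x" for x
    using closest_point_self[of "g x" "cball 0 B"] B by (simp add: P_def)
  have \<theta>: "0 \<le> \<theta> x" "\<theta> x \<le> 1" "norm x \<le> R \<Longrightarrow> \<theta> x = 1" "norm x > R + 1 \<Longrightarrow> \<theta> x = 0" for x
    by (auto simp: \<theta>_def)
  have cd: "continuous_on UNIV (d n)" for n
    unfolding d_def \<theta>_def
    by (intro continuous_intros continuous_on_compose2[OF cP] c) auto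
  have [measurable]: "d n \<in> borel_measurable borel" for n
    using cd by (rule borel_measurable_continuous_onI)
  have dB: "norm (d n x) \<le> B" for n x
    using mult_mono[OF \<theta>(2) P] \<theta>(1) by (simp add: d_def)
  have d0: "d n x = 0" if "norm x > R + 1" for n x using \<theta>(4)[OF that] by (simp add: d_def)
  have lim: "(\<lambda>n. d n x) \<longlonglongrightarrow> g x" if "x \<notin> N" for x
  proof -
    have "isCont P (g x)" using cP by (simp add: continuous_on_eq_continuous_at)
    then have "(\<lambda>n. P (c n x)) \<longlonglongrightarrow> g x"
      using isCont_tendsto_compose[OF _ c(2)[OF that], of P] Pg by simp
    then have "(\<lambda>n. d n x) \<longlonglongrightarrow> \<theta> x *\<^sub>R g x"
      unfolding d_def by (intro tendsto_intros)
    moreover have "\<theta> x *\<^sub>R g x = g x" using \<theta>(3)[of x] R[of x] by (cases "norm x \<le> R") auto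
    ultimately show ?thesis by simp
  qed
  have "AE x in lebesgue. x \<notin> N"
    using N by (simp add: negligible_iff_null_sets AE_not_in)
  then have AEN: "AE x in lborel. x \<notin> N" by (simp add: AE_completion_iff)
  have "(\<lambda>n. \<integral>x. norm (d n x - g x) \<partial>lborel) \<longlonglongrightarrow> (\<integral>x. 0 \<partial>(lborel :: 'a measure))"
  proof (rule integral_dominated_convergence[where w = "\<lambda>x. indicator (cball 0 (R + 1)) x * (2 * B)"])
    show "integrable lborel (\<lambda>x. indicator (cball (0::'a) (R + 1)) x * (2 * B))"
      by (intro integrable_mult_left integrable_real_indicator emeasure_compact_finite) auto
    show "AE x in lborel. (\<lambda>n. norm (d n x - g x)) \<longlonglongrightarrow> 0"
      using AEN by eventually_elim (use lim in \<open>simp add: LIM_zero tendsto_norm_zero\<close>)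
    show "AE x in lborel. norm (norm (d n x - g x)) \<le> indicator (cball 0 (R + 1)) x * (2 * B)" for n
    proof (rule AE_I2)
      fix x show "norm (norm (d n x - g x)) \<le> indicator (cball 0 (R + 1)) x * (2 * B)"
        using norm_triangle_ineq4[of "d n x" "g x"] dB[of n x] B[of x] d0[of x n] R[of x]
        by (cases "norm x > R + 1") auto
    qed
  qed auto
  then have "(\<lambda>n. \<integral>x. norm (d n x - g x) \<partial>lborel) \<longlonglongrightarrow> 0" by simp
  from order_tendstoD(2)[OF this \<open>e > 0\<close>] obtain n where "(\<integral>x. norm (d n x - g x) \<partial>lborel) < e"
    by (auto simp: eventually_sequentially)
  from that[OF cd dB d0 this] show thesis .
qed

text \<open>A three-term estimate: \<open>g\<close> is replaced by a continuous \<open>c\<close>, at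
  equal cost for the function and its translate, and \<open>c\<close> is handled by dominated
  convergence. The latter needs sequences, hence the sequential form of the limit.\<close>

lemma translation_L1_continuous:
  fixes g :: "'a::euclidean_space \<Rightarrow> 'b::euclidean_space"
  assumes g [measurable]: "g \<in> borel_measurable borel"
    and B: "\<And>x. norm (g x) \<le> B" and R: "\<And>x. norm x > R \<Longrightarrow> g x = 0"
  shows "((\<lambda>z. \<integral>x. norm (g (x - z) - g x) \<partial>lborel) \<longlongrightarrow> 0) (at 0)"
proof (rule tendsto_at_iff_sequentially[THEN iffD2])
  have B0: "B \<ge> 0" using B[of 0] norm_ge_zero order_trans by blast
  show "\<forall>X. (\<forall>i. X i \<in> UNIV - {0}) \<longrightarrow> X \<longlonglongrightarrow> 0 \<longrightarrow>
      ((\<lambda>z. \<integral>x. norm (g (x - z) - g x) \<partial>lborel) \<circ> X) \<longlonglongrightarrow> 0"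
  proof (intro allI impI)
    fix X :: "nat \<Rightarrow> 'a" assume X: "X \<longlonglongrightarrow> 0"
    show "((\<lambda>z. \<integral>x. norm (g (x - z) - g x) \<partial>lborel) \<circ> X) \<longlonglongrightarrow> 0"
    proof (rule LIMSEQ_I)
      fix e :: real assume e: "e > 0"
      then have e3: "e / 3 > 0" by simp
      obtain c where c: "continuous_on UNIV c" "\<And>x. norm (c x) \<le> B" "\<And>x. norm x > R + 1 \<Longrightarrow> c x = 0"
          "(\<integral>x. norm (c x - g x) \<partial>lborel) < e / 3"
        using L1_dense_continuous[OF g B R e3] by blast
      have [measurable]: "c \<in> borel_measurable borel"
        using c(1) by (rule borel_measurable_continuous_onI)
      have ig: "integrable lborel g" by (rule integrable_bounded_support[OF g B R])
      have ic: "integrable lborel c" by (rule integrable_bounded_support[OF _ c(2,3)]) auto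
      have [measurable]: "cball (0::'a) (R + 2) \<in> sets borel" by simp
      \<comment> \<open>The indicator provides an integrable majorant for every \<open>n\<close>.
        Once \<open>norm (X n) < 1\<close> it changes nothing, since \<open>c\<close> vanishes
        outside radius \<open>R + 1\<close>.\<close>
      have "(\<lambda>n. \<integral>x. norm (c (x - X n) - c x) * indicator (cball 0 (R + 2)) x \<partial>lborel) \<longlonglongrightarrow>
          (\<integral>x. 0 \<partial>(lborel :: 'a measure))"
      proof (rule integral_dominated_convergence[where w = "\<lambda>x. indicator (cball 0 (R + 2)) x * (2 * B)"])
        show "integrable lborel (\<lambda>x. indicator (cball (0::'a) (R + 2)) x * (2 * B))"
          by (intro integrable_mult_left integrable_real_indicator emeasure_compact_finite) auto
        show "AE x in lborel. (\<lambda>n. norm (c (x - X n) - c x) * indicator (cball 0 (R + 2)) x) \<longlonglongrightarrow> 0"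
        proof (rule AE_I2)
          fix x
          have "isCont c x" using c(1) by (simp add: continuous_on_eq_continuous_at)
          moreover have "(\<lambda>n. x - X n) \<longlonglongrightarrow> x" using tendsto_diff[OF tendsto_const X, of x] by simp
          ultimately have "(\<lambda>n. c (x - X n)) \<longlonglongrightarrow> c x" by (rule isCont_tendsto_compose)
          then have "(\<lambda>n. norm (c (x - X n) - c x)) \<longlonglongrightarrow> 0" by (intro tendsto_norm_zero LIM_zero)
          then show "(\<lambda>n. norm (c (x - X n) - c x) * indicator (cball 0 (R + 2)) x) \<longlonglongrightarrow> 0"
            by (rule tendsto_mult_left_zero)
        qed
        show "AE x in lborel. norm (norm (c (x - X n) - c x) * indicator (cball 0 (R + 2)) x)
            \<le> indicator (cball 0 (R + 2)) x * (2 * B)" for n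
        proof (rule AE_I2)
          fix x show "norm (norm (c (x - X n) - c x) * indicator (cball 0 (R + 2)) x)
              \<le> indicator (cball 0 (R + 2)) x * (2 * B)"
            using norm_triangle_ineq4[of "c (x - X n)" "c x"] c(2)[of "x - X n"] c(2)[of x]
            by (auto simp: indicator_def)
        qed
      qed measurable
      then have "(\<lambda>n. \<integral>x. norm (c (x - X n) - c x) * indicator (cball 0 (R + 2)) x \<partial>lborel) \<longlonglongrightarrow> 0"
        by simp
      then have "eventually (\<lambda>n. (\<integral>x. norm (c (x - X n) - c x) * indicator (cball 0 (R + 2)) x \<partial>lborel) < e / 3) sequentially"
        by (rule order_tendstoD) (use e in simp)
      moreover have "eventually (\<lambda>n. norm (X n) < 1) sequentially"
        using order_tendstoD(2)[OF tendsto_norm_zero[OF X], of 1] by simp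
      ultimately have "eventually (\<lambda>n. norm ((\<integral>x. norm (g (x - X n) - g x) \<partial>lborel) - 0) < e) sequentially"
      proof eventually_elim
        case (elim n)
        have *: "norm (c (x - X n) - c x) * indicator (cball 0 (R + 2)) x = norm (c (x - X n) - c x)" for x
        proof (cases "norm x > R + 2")
          case True
          have "norm x \<le> norm (x - X n) + norm (X n)" using norm_triangle_sub[of x "X n"] by simp
          with True elim c(3)[of x] c(3)[of "x - X n"] show ?thesis by simp
        qed auto
        have i: "integrable lborel (\<lambda>x. norm (c (x - X n) - g (x - X n)))"
            "integrable lborel (\<lambda>x. norm (c (x - X n) - c x))" "integrable lborel (\<lambda>x. norm (c x - g x))"
            "integrable lborel (\<lambda>x. norm (g (x - X n) - g x))"
          by (intro integrable_norm Bochner_Integration.integrable_diff integrable_lborel_shift ig ic)+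
        have "(\<integral>x. norm (g (x - X n) - g x) \<partial>lborel) \<le>
          (\<integral>x. norm (c (x - X n) - g (x - X n)) + norm (c (x - X n) - c x) + norm (c x - g x) \<partial>lborel)"
        proof (rule integral_mono[OF i(4)])
          fix x
          have "g (x - X n) - g x = - (c (x - X n) - g (x - X n)) + (c (x - X n) - c x) + (c x - g x)"
            by simp
          then show "norm (g (x - X n) - g x) \<le>
              norm (c (x - X n) - g (x - X n)) + norm (c (x - X n) - c x) + norm (c x - g x)"
            by (metis norm_minus_cancel norm_triangle_mono order_refl)
        qed (intro Bochner_Integration.integrable_add i)
        also have "\<dots> = (\<integral>x. norm (c (x - X n) - g (x - X n)) \<partial>lborel) +
            (\<integral>x. norm (c (x - X n) - c x) \<partial>lborel) + (\<integral>x. norm (c x - g x) \<partial>lborel)"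
          by (simp add: i)
        also have "(\<integral>x. norm (c (x - X n) - g (x - X n)) \<partial>lborel) = (\<integral>x. norm (c x - g x) \<partial>lborel)"
          by (rule integral_lborel_shift[where f = "\<lambda>x. norm (c x - g x)"]) auto
        also have "\<dots> + (\<integral>x. norm (c (x - X n) - c x) \<partial>lborel) + (\<integral>x. norm (c x - g x) \<partial>lborel) < e"
          using elim c(4) by (simp add: *)
        finally show ?case by (simp add: integral_nonneg_AE)
      qed
      then show "\<exists>no. \<forall>n\<ge>no. norm (((\<lambda>z. \<integral>x. norm (g (x - z) - g x) \<partial>lborel) \<circ> X) n - 0) < e"
        by (simp add: eventually_sequentially)
    qed
  qed
qed

text \<open>After exchanging the integrals, translating by \<open>s y\<close> leaves only the
  displacement \<open>y - s y\<close>. The map \<open>s\<close> is arbitrary because two cases are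
  needed: simple functions near the identity for Minkowski's inequality, and \<open>s = 0\<close> to
  compare a mollified function with the original.\<close>

lemma convolution_L1_difference:
  fixes g :: "'a::euclidean_space \<Rightarrow> 'b::euclidean_space" and \<phi> :: "'a \<Rightarrow> real" and s :: "'a \<Rightarrow> 'a"
  assumes g [measurable]: "g \<in> borel_measurable borel"
    and B: "\<And>x. norm (g x) \<le> B" and R: "\<And>x. norm x > R \<Longrightarrow> g x = 0"
    and \<phi>: "integrable lborel \<phi>" "\<And>y. \<phi> y \<ge> 0"
    and s [measurable]: "s \<in> borel_measurable borel"
  shows "(\<integral>\<^sup>+x. ennreal (norm ((\<integral>y. \<phi> y *\<^sub>R g (x - y) \<partial>lborel) - (\<integral>y. \<phi> y *\<^sub>R g (x - s y) \<partial>lborel))) \<partial>lborel)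
    \<le> (\<integral>\<^sup>+y. ennreal (\<phi> y * (\<integral>x. norm (g (x - (y - s y)) - g x) \<partial>lborel)) \<partial>lborel)"
proof -
  have [measurable]: "\<phi> \<in> borel_measurable borel" using \<phi> by auto
  have ig: "integrable lborel g" by (rule integrable_bounded_support[OF g B R])
  have int: "integrable lborel (\<lambda>y. \<phi> y *\<^sub>R g (x - t y))" if [measurable]: "t \<in> borel_measurable borel" for t x
  proof (rule Bochner_Integration.integrable_bound[where f = "\<lambda>y. \<phi> y * B"])
    show "AE y in lborel. norm (\<phi> y *\<^sub>R g (x - t y)) \<le> norm (\<phi> y * B)"
    proof (rule AE_I2)
      fix y show "norm (\<phi> y *\<^sub>R g (x - t y)) \<le> norm (\<phi> y * B)"
        using B[of "x - t y"] by (auto simp: abs_mult intro!: mult_left_mono)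
    qed
  qed (use \<phi> in auto)
  have "(\<integral>\<^sup>+x. ennreal (norm ((\<integral>y. \<phi> y *\<^sub>R g (x - y) \<partial>lborel) - (\<integral>y. \<phi> y *\<^sub>R g (x - s y) \<partial>lborel))) \<partial>lborel)
    \<le> (\<integral>\<^sup>+x. \<integral>\<^sup>+y. ennreal (norm (\<phi> y *\<^sub>R g (x - y) - \<phi> y *\<^sub>R g (x - s y))) \<partial>lborel \<partial>lborel)"
  proof (rule nn_integral_mono)
    fix x
    have i: "integrable lborel (\<lambda>y. \<phi> y *\<^sub>R g (x - y) - \<phi> y *\<^sub>R g (x - s y))"
      using int[of "\<lambda>y. y" x] int[OF s, of x] by simp
    have "(\<integral>y. \<phi> y *\<^sub>R g (x - y) \<partial>lborel) - (\<integral>y. \<phi> y *\<^sub>R g (x - s y) \<partial>lborel) =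
        (\<integral>y. \<phi> y *\<^sub>R g (x - y) - \<phi> y *\<^sub>R g (x - s y) \<partial>lborel)"
      using int[of "\<lambda>y. y" x] int[OF s, of x] by simp
    then show "ennreal (norm ((\<integral>y. \<phi> y *\<^sub>R g (x - y) \<partial>lborel) - (\<integral>y. \<phi> y *\<^sub>R g (x - s y) \<partial>lborel)))
        \<le> (\<integral>\<^sup>+y. ennreal (norm (\<phi> y *\<^sub>R g (x - y) - \<phi> y *\<^sub>R g (x - s y))) \<partial>lborel)"
      using integral_norm_bound_ennreal[OF i] by simp
  qed
  also have "\<dots> = (\<integral>\<^sup>+y. \<integral>\<^sup>+x. ennreal (norm (\<phi> y *\<^sub>R g (x - y) - \<phi> y *\<^sub>R g (x - s y))) \<partial>lborel \<partial>lborel)"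
    by (rule lborel_pair.Fubini') measurable
  also have "\<dots> = (\<integral>\<^sup>+y. ennreal (\<phi> y * (\<integral>x. norm (g (x - (y - s y)) - g x) \<partial>lborel)) \<partial>lborel)"
  proof (rule nn_integral_cong)
    fix y
    let ?f = "\<lambda>x. norm (g (x - (y - s y)) - g x)"
    have "(\<integral>\<^sup>+x. ennreal (norm (\<phi> y *\<^sub>R g (x - y) - \<phi> y *\<^sub>R g (x - s y))) \<partial>lborel) =
      (\<integral>\<^sup>+x. ennreal (\<phi> y) * ennreal (?f (x - s y)) \<partial>lborel)"
      by (intro nn_integral_cong)
         (simp add: scaleR_diff_right[symmetric] ennreal_mult'[symmetric] \<phi>)
    also have "\<dots> = ennreal (\<phi> y) * (\<integral>\<^sup>+x. ennreal (?f (x - s y)) \<partial>lborel)"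
      by (rule nn_integral_cmult) measurable
    also have "(\<integral>\<^sup>+x. ennreal (?f (x - s y)) \<partial>lborel) = (\<integral>\<^sup>+x. ennreal (?f x) \<partial>lborel)"
      by (rule nn_integral_lborel_shift[where f = "\<lambda>x. ennreal (?f x)"]) measurable
    also have "\<dots> = ennreal (\<integral>x. ?f x \<partial>lborel)"
      by (rule nn_integral_eq_integral)
         (auto intro!: Bochner_Integration.integrable_diff integrable_lborel_shift ig)
    finally show "(\<integral>\<^sup>+x. ennreal (norm (\<phi> y *\<^sub>R g (x - y) - \<phi> y *\<^sub>R g (x - s y))) \<partial>lborel) =
        ennreal (\<phi> y * (\<integral>x. ?f x \<partial>lborel))"
      by (simp add: ennreal_mult' \<phi>)
  qed
  finally show ?thesis .
qed

section \<open>The mollifier\<close>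

lemma mollifier_exists:
  assumes r: "r > 0"
  obtains \<phi> :: "'a::euclidean_space \<Rightarrow> real" where "smooth_fun (\<lambda>x. complex_of_real (\<phi> x))" "\<And>x. \<phi> x \<ge> 0"
    "\<And>x. norm x \<ge> r \<Longrightarrow> \<phi> x = 0" "integrable lborel \<phi>" "(\<integral>x. \<phi> x \<partial>lborel) = 1"
proof -
  define \<eta> where "\<eta> x = flat 0 (r\<^sup>2 - x \<bullet> x)" for x :: 'a
  define I where "I = (\<integral>x. \<eta> x \<partial>lborel)"
  have alg: "(\<lambda>x. of_real (\<eta> x)) \<in> bump_algebra (r\<^sup>2)"
    unfolding \<eta>_def by (rule bump_algebra.flat)
  have nn: "\<eta> x \<ge> 0" for x by (simp add: \<eta>_def flat_nonneg)
  \<comment> \<open>One direction gives the support; the other, strict positivity in the open ball,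
    gives nonzero mass.\<close>
  have supp: "\<eta> x = 0 \<longleftrightarrow> norm x \<ge> r" for x
    using r by (auto simp: \<eta>_def flat_def power2_norm_eq_inner[symmetric] power2_le_iff_abs_le
        abs_le_square_iff[symmetric])
  have "continuous_on UNIV (\<lambda>x. Re (of_real (\<eta> x)))"
    by (intro continuous_intros smooth_fun_continuous_on[OF bump_algebra_smooth[OF alg]])
  then have [measurable]: "\<eta> \<in> borel_measurable borel"
    by (simp add: borel_measurable_continuous_onI)
  have int: "integrable lborel \<eta>"
  proof (rule integrable_bounded_support[where B = 1 and R = r])
    show "norm (\<eta> x) \<le> 1" for x by (auto simp: \<eta>_def flat_def)
  qed (use supp in auto)
  have "I \<noteq> 0"
  proof
    assume "I = 0"
    then have "AE x in lborel. \<eta> x = 0"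
      unfolding I_def using integral_nonneg_eq_0_iff_AE[OF int] nn by simp
    then have "AE x in lebesgue. x \<notin> ball (0::'a) r"
      by (intro AE_completion) (simp add: supp not_less)
    then have "negligible (ball (0::'a) r)"
      by (simp add: negligible_iff_null_sets AE_iff_null_sets)
    then show False using open_not_negligible[of "ball (0::'a) r"] r by auto
  qed
  moreover have "I \<ge> 0" unfolding I_def using nn by simp
  ultimately have I: "I > 0" by simp
  show thesis
  proof (rule that[of "\<lambda>x. inverse I * \<eta> x"])
    have "(\<lambda>x. of_real (inverse I) * of_real (\<eta> x)) \<in> bump_algebra (r\<^sup>2)"
      by (intro bump_algebra.mult bump_algebra.const alg)
    then show "smooth_fun (\<lambda>x. complex_of_real (inverse I * \<eta> x))"
      using bump_algebra_smooth by fastforce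
    show "(\<integral>x. inverse I * \<eta> x \<partial>lborel) = 1" using I by (simp add: I_def)
  qed (use I nn supp int in auto)
qed

subsection \<open>Banach function norms\<close>

locale bfn =
  fixes \<rho> :: "('a::euclidean_space \<Rightarrow> ennreal) \<Rightarrow> ennreal"
  assumes bfn: "banach_function_norm \<rho>"
begin

lemma rho_mono:
  assumes "f \<in> borel_measurable lebesgue" "g \<in> borel_measurable lebesgue" "AE x in lebesgue. g x \<le> f x"
  shows "\<rho> g \<le> \<rho> f"
  using bfn assms unfolding banach_function_norm_def by blast

lemma rho_cmult:
  assumes "f \<in> borel_measurable lebesgue" "a \<ge> 0"
  shows "\<rho> (\<lambda>x. ennreal a * f x) = ennreal a * \<rho> f"
  using bfn assms unfolding banach_function_norm_def by blast

lemma rho_add: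
  assumes "f \<in> borel_measurable lebesgue" "g \<in> borel_measurable lebesgue"
  shows "\<rho> (\<lambda>x. f x + g x) \<le> \<rho> f + \<rho> g"
  using bfn assms unfolding banach_function_norm_def by blast

lemma rho_zero: "\<rho> (\<lambda>x. 0) = 0"
  using rho_cmult[of "\<lambda>x. 0" 0] by simp

lemma rho_sum:
  assumes "finite A" "\<And>i. i \<in> A \<Longrightarrow> f i \<in> borel_measurable lebesgue"
  shows "\<rho> (\<lambda>x. \<Sum>i\<in>A. f i x) \<le> (\<Sum>i\<in>A. \<rho> (f i))"
  using assms
proof induction
  case (insert i A)
  have "\<rho> (\<lambda>x. f i x + (\<Sum>i\<in>A. f i x)) \<le> \<rho> (f i) + \<rho> (\<lambda>x. \<Sum>i\<in>A. f i x)"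
    using insert.prems by (intro rho_add borel_measurable_sum) auto
  also have "\<dots> \<le> \<rho> (f i) + (\<Sum>i\<in>A. \<rho> (f i))"
    using insert by (intro add_left_mono) auto
  finally show ?case using insert.hyps by simp
qed (simp add: rho_zero)

text \<open>The Fatou property. (A3) needs monotone sequences, so \<open>F j\<close> is replaced by
  the infima over its tails, which increase to the limit and lie below \<open>F\<close>.\<close>

lemma rho_lim_le:
  assumes F: "\<And>j. F j \<in> borel_measurable lebesgue" and f: "f \<in> borel_measurable lebesgue"
    and lim: "AE x in lebesgue. (\<lambda>j. F j x) \<longlonglongrightarrow> f x" and M: "\<And>j. \<rho> (F j) \<le> M"
  shows "\<rho> f \<le> M"
proof -
  define G where "G k x = (INF j\<in>{k..}. F j x)" for k x
  have G [measurable]: "G k \<in> borel_measurable lebesgue" for k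
    unfolding G_def using F by measurable
  have inc: "incseq (\<lambda>k. G k x)" for x
    unfolding G_def by (intro incseq_SucI INF_superset_mono) auto
  have "(\<lambda>k. G k x) \<longlonglongrightarrow> f x" if "(\<lambda>j. F j x) \<longlonglongrightarrow> f x" for x
  proof -
    have "(\<lambda>k. G k x) \<longlonglongrightarrow> (SUP k. G k x)" by (rule LIMSEQ_SUP[OF inc])
    also have "(SUP k. G k x) = liminf (\<lambda>j. F j x)" by (simp add: liminf_SUP_INF G_def)
    also have "\<dots> = f x" by (rule lim_imp_Liminf[OF _ that]) simp
    finally show ?thesis .
  qed
  with lim inc have "AE x in lebesgue. incseq (\<lambda>k. G k x) \<and> (\<lambda>k. G k x) \<longlonglongrightarrow> f x" by auto
  with bfn f G have "(\<lambda>k. \<rho> (G k)) \<longlonglongrightarrow> \<rho> f"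
    unfolding banach_function_norm_def by blast
  moreover have "\<rho> (G k) \<le> M" for k
  proof -
    have "AE x in lebesgue. G k x \<le> F k x" by (rule AE_I2) (auto simp: G_def intro: INF_lower)
    from rho_mono[OF F G this] M[of k] show ?thesis by (rule order_trans)
  qed
  ultimately show ?thesis by (intro LIMSEQ_le_const2) auto
qed

text \<open>Invariance is postulated only for complex-valued elements of the space; hence the
  finiteness assumption and the passage through \<open>complex_of_real\<close>.\<close>

lemma rho_translate:
  assumes ti: "translation_invariant \<rho>"
    and [measurable]: "g \<in> borel_measurable borel" and g: "\<And>x. g x \<ge> 0"
    and fin: "\<rho> (\<lambda>x. ennreal (g x)) < \<infinity>"
  shows "\<rho> (\<lambda>x. ennreal (g (x - y))) = \<rho> (\<lambda>x. ennreal (g x))"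
proof -
  have "(\<lambda>x. complex_of_real (g x)) \<in> borel_measurable lebesgue"
    by (intro measurable_completion) simp
  then have "(\<lambda>x. complex_of_real (g x)) \<in> bfs_space \<rho>" using fin g by (simp add: bfs_space_def)
  from ti[unfolded translation_invariant_def, THEN bspec, OF this, THEN spec, of y]
  have "bfs_norm \<rho> (\<lambda>x. complex_of_real (g (x - y))) = bfs_norm \<rho> (\<lambda>x. complex_of_real (g x))" .
  then show ?thesis using g by (simp add: bfs_norm_def)
qed

text \<open>Minkowski's inequality without duality: replacing the variable of integration by simple
  functions that converge to the identity turns the convolution into convex combinations of
  translates, which converge in L1 because translation is continuous there.\<close>

lemma rho_convolution_le:
  assumes ti: "translation_invariant \<rho>"
    and g [measurable]: "g \<in> borel_measurable borel" and g0: "\<And>x. g x \<ge> 0"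
    and B: "\<And>x. g x \<le> B" and R: "\<And>x. norm x > R \<Longrightarrow> g x = 0"
    and fin: "\<rho> (\<lambda>x. ennreal (g x)) < \<infinity>"
    and \<phi>: "integrable lborel \<phi>" "\<And>y. \<phi> y \<ge> 0" "(\<integral>y. \<phi> y \<partial>lborel) = 1"
  shows "\<rho> (\<lambda>x. ennreal (\<integral>y. \<phi> y * g (x - y) \<partial>lborel)) \<le> \<rho> (\<lambda>x. ennreal (g x))"
proof -
  have [measurable]: "\<phi> \<in> borel_measurable borel" using \<phi> by auto
  have B': "norm (g x) \<le> B" for x using B g0 by simp
  have ig: "integrable lborel g" by (rule integrable_bounded_support[OF g B' R])
  have "(\<lambda>x::'a. x) \<in> borel_measurable lborel" by simp
  from borel_measurable_implies_sequence_metric[OF this, of 0]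
  obtain s :: "nat \<Rightarrow> 'a \<Rightarrow> 'a" where s: "\<And>i. simple_function lborel (s i)" "\<And>y. (\<lambda>i. s i y) \<longlonglongrightarrow> y"
    by auto
  have sm [measurable]: "s i \<in> borel_measurable borel" for i
    using borel_measurable_simple_function[OF s(1)] by simp
  define h where "h i x = (\<integral>y. \<phi> y * g (x - s i y) \<partial>lborel)" for i x
  define H where "H x = (\<integral>y. \<phi> y * g (x - y) \<partial>lborel)" for x
  have hm [measurable]: "h i \<in> borel_measurable borel" for i unfolding h_def by measurable
  have Hm [measurable]: "H \<in> borel_measurable borel" unfolding H_def by measurable
  have h_le: "\<rho> (\<lambda>x. ennreal (h i x)) \<le> \<rho> (\<lambda>x. ennreal (g x))" for i
  proof -
    let ?K = "range (s i)"
    have finK: "finite ?K" using simple_functionD(1)[OF s(1)] by simp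
    \<comment> \<open>The weight of the translate by \<open>k\<close> is the mass that
      \<open>\<phi>\<close> gives to the level set of \<open>s i\<close>; the weights add up to the
      total mass 1.\<close>
    define c where "c k = (\<integral>y. \<phi> y * indicator {y. s i y = k} y \<partial>lborel)" for k
    have [measurable]: "{y. s i y = k} \<in> sets borel" for k by measurable
    have ic: "integrable lborel (\<lambda>y. \<phi> y * indicator {y. s i y = k} y)" for k
      by (rule Bochner_Integration.integrable_bound[OF \<phi>(1)]) (auto simp: indicator_def)
    have c0: "c k \<ge> 0" for k unfolding c_def by (intro integral_nonneg_AE) (auto simp: \<phi>)
    have split: "\<psi> (s i y) = (\<Sum>k\<in>?K. indicator {y. s i y = k} y * \<psi> k)" for y and \<psi> :: "'a \<Rightarrow> real"
      by (subst sum.remove[OF finK, of "s i y"]) (auto simp: indicator_def intro!: sum.neutral)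
    have h: "h i x = (\<Sum>k\<in>?K. c k * g (x - k))" for x
    proof -
      have "h i x = (\<integral>y. (\<Sum>k\<in>?K. (\<phi> y * indicator {y. s i y = k} y) * g (x - k)) \<partial>lborel)"
        unfolding h_def by (subst split[of "\<lambda>k. g (x - k)"]) (simp add: sum_distrib_left mult.assoc)
      also have "\<dots> = (\<Sum>k\<in>?K. c k * g (x - k))"
        unfolding c_def using ic by (subst Bochner_Integration.integral_sum) auto
      finally show ?thesis .
    qed
    have "1 = (\<integral>y. (\<Sum>k\<in>?K. \<phi> y * indicator {y. s i y = k} y) \<partial>lborel)"
      unfolding \<phi>(3)[symmetric]
      by (intro Bochner_Integration.integral_cong refl)
         (use split[of "\<lambda>_. 1"] in \<open>simp add: sum_distrib_left[symmetric]\<close>)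
    also have "\<dots> = (\<Sum>k\<in>?K. c k)"
      unfolding c_def using ic by (subst Bochner_Integration.integral_sum) auto
    finally have c1: "(\<Sum>k\<in>?K. c k) = 1" by simp
    have m: "(\<lambda>x. ennreal (g (x - k))) \<in> borel_measurable lebesgue" for k
      by (intro measurable_completion) simp
    have "\<rho> (\<lambda>x. ennreal (h i x)) = \<rho> (\<lambda>x. \<Sum>k\<in>?K. ennreal (c k) * ennreal (g (x - k)))"
      by (simp add: h c0 g0 sum_ennreal flip: ennreal_mult)
    also have "\<dots> \<le> (\<Sum>k\<in>?K. \<rho> (\<lambda>x. ennreal (c k) * ennreal (g (x - k))))"
      using m by (intro rho_sum finK) auto
    also have "\<dots> = (\<Sum>k\<in>?K. ennreal (c k) * \<rho> (\<lambda>x. ennreal (g x)))"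
      by (simp add: rho_cmult[OF m c0] rho_translate[OF ti g g0 fin])
    also have "\<dots> = \<rho> (\<lambda>x. ennreal (g x))"
      by (simp add: c0 c1 sum_ennreal flip: sum_distrib_right)
    finally show ?thesis .
  qed
  define \<omega> where "\<omega> = (\<lambda>z. (\<integral>x. norm (g (x - z) - g x) \<partial>lborel))"
  have [measurable]: "\<omega> \<in> borel_measurable borel" unfolding \<omega>_def by measurable
  define C where "C = 2 * (\<integral>x. g x \<partial>lborel)"
  have \<omega>0: "\<omega> z \<ge> 0" for z unfolding \<omega>_def by simp
  have \<omega>C: "\<omega> z \<le> C" for z
  proof -
    have "\<omega> z \<le> (\<integral>x. g (x - z) + g x \<partial>lborel)"
      unfolding \<omega>_def
    proof (rule integral_mono)
      show "norm (g (x - z) - g x) \<le> g (x - z) + g x" for x using g0[of x] g0[of "x - z"] by simp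
    qed (intro integrable_norm Bochner_Integration.integrable_diff Bochner_Integration.integrable_add
        integrable_lborel_shift ig)+
    also have "\<dots> = C"
      using ig integrable_lborel_shift[OF ig, of z] integral_lborel_shift[OF g, of z] by (simp add: C_def)
    finally show ?thesis .
  qed
  \<comment> \<open>The known limit is punctured. As \<open>\<omega> 0 = 0\<close>, it amounts to
    continuity at 0, which also covers indices with \<open>s i y = y\<close>.\<close>
  have \<omega>lim: "(\<omega> \<longlongrightarrow> \<omega> 0) (at 0)"
  proof -
    have "((\<lambda>z. \<integral>x. norm (g (x - z) - g x) \<partial>lborel) \<longlongrightarrow> 0) (at 0)"
      by (rule translation_L1_continuous[OF g B' R])
    then show ?thesis by (simp add: \<omega>_def)
  qed
  have "(\<lambda>i. \<integral>y. \<phi> y * \<omega> (y - s i y) \<partial>lborel) \<longlonglongrightarrow> (\<integral>y. 0 \<partial>(lborel::'a measure))"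
  proof (rule integral_dominated_convergence[where w = "\<lambda>y. \<phi> y * C"])
    show "AE y in lborel. (\<lambda>i. \<phi> y * \<omega> (y - s i y)) \<longlonglongrightarrow> 0"
    proof (rule AE_I2)
      fix y
      have "(\<lambda>i. y - s i y) \<longlonglongrightarrow> 0" using tendsto_diff[OF tendsto_const s(2), of y y] by simp
      moreover have "isCont \<omega> 0" using \<omega>lim by (simp add: isCont_def)
      ultimately have "(\<lambda>i. \<omega> (y - s i y)) \<longlonglongrightarrow> \<omega> 0" by (rule isCont_tendsto_compose[rotated])
      then have "(\<lambda>i. \<omega> (y - s i y)) \<longlonglongrightarrow> 0" by (simp add: \<omega>_def)
      then show "(\<lambda>i. \<phi> y * \<omega> (y - s i y)) \<longlonglongrightarrow> 0" by (rule tendsto_mult_right_zero)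
    qed
    show "AE y in lborel. norm (\<phi> y * \<omega> (y - s i y)) \<le> \<phi> y * C" for i
      by (rule AE_I2) (auto simp: \<omega>0 \<phi> \<omega>C intro!: mult_left_mono)
  qed (use \<phi> in auto)
  then have lim0: "(\<lambda>i. \<integral>y. \<phi> y * \<omega> (y - s i y) \<partial>lborel) \<longlonglongrightarrow> 0" by simp
  have bound: "(\<integral>\<^sup>+x. ennreal (norm (H x - h i x)) \<partial>lborel) \<le> ennreal (\<integral>y. \<phi> y * \<omega> (y - s i y) \<partial>lborel)" for i
  proof -
    have "integrable lborel (\<lambda>y. \<phi> y * \<omega> (y - s i y))"
    proof (rule Bochner_Integration.integrable_bound[where f = "\<lambda>y. \<phi> y * C"])
      show "AE y in lborel. norm (\<phi> y * \<omega> (y - s i y)) \<le> norm (\<phi> y * C)"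
        by (rule AE_I2) (auto simp: \<omega>0 \<phi> abs_mult intro!: mult_left_mono order_trans[OF \<omega>C])
    qed (use \<phi> in auto)
    then have "(\<integral>\<^sup>+y. ennreal (\<phi> y * \<omega> (y - s i y)) \<partial>lborel) = ennreal (\<integral>y. \<phi> y * \<omega> (y - s i y) \<partial>lborel)"
      by (rule nn_integral_eq_integral) (simp add: \<phi> \<omega>0)
    moreover have "(\<integral>\<^sup>+x. ennreal (norm (H x - h i x)) \<partial>lborel) \<le> (\<integral>\<^sup>+y. ennreal (\<phi> y * \<omega> (y - s i y)) \<partial>lborel)"
      unfolding H_def h_def \<omega>_def
      by (rule convolution_L1_difference[OF g B' R \<phi>(1,2) sm, unfolded real_scaleR_def])
    ultimately show ?thesis by simp
  qed
  have int: "integrable lborel (\<lambda>x. H x - h i x)" for i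
    by (rule integrableI_bounded) (use bound[of i] in \<open>auto intro: le_less_trans\<close>)
  have nn: "(\<integral>x. norm (H x - h i x) \<partial>lborel) \<le> (\<integral>y. \<phi> y * \<omega> (y - s i y) \<partial>lborel)" for i
  proof -
    have "ennreal (\<integral>x. norm (H x - h i x) \<partial>lborel) \<le> ennreal (\<integral>y. \<phi> y * \<omega> (y - s i y) \<partial>lborel)"
      using bound[of i] nn_integral_eq_integral[OF integrable_norm[OF int[of i]]] by simp
    moreover have "(\<integral>y. \<phi> y * \<omega> (y - s i y) \<partial>lborel) \<ge> 0" by (simp add: \<phi> \<omega>0)
    ultimately show ?thesis by (simp add: ennreal_le_iff)
  qed
  have "(\<lambda>i. \<integral>x. norm (H x - h i x) \<partial>lborel) \<longlonglongrightarrow> 0"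
    by (rule tendsto_sandwich[OF _ _ tendsto_const lim0]; intro always_eventually allI) (rule nn | simp)+
  \<comment> \<open>A subsequence is enough, because \<open>h_le\<close> bounds every
    \<open>h i\<close> by the same number.\<close>
  from tendsto_L1_AE_subseq[OF int this] obtain r where
    r: "AE x in lborel. (\<lambda>n. H x - h (r n) x) \<longlonglongrightarrow> 0" by blast
  have "\<rho> (\<lambda>x. ennreal (H x)) \<le> \<rho> (\<lambda>x. ennreal (g x))"
  proof (rule rho_lim_le)
    show "AE x in lebesgue. (\<lambda>j. ennreal (h (r j) x)) \<longlonglongrightarrow> ennreal (H x)"
    proof (rule AE_completion)
      show "AE x in lborel. (\<lambda>j. ennreal (h (r j) x)) \<longlonglongrightarrow> ennreal (H x)"
        using r
      proof eventually_elim
        case (elim x)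
        have "(\<lambda>n. H x - (H x - h (r n) x)) \<longlonglongrightarrow> H x - 0" by (intro tendsto_diff tendsto_const elim)
        then show ?case by (intro tendsto_ennrealI) simp
      qed
    qed
  qed (auto intro: h_le measurable_completion)
  then show ?thesis by (simp add: H_def)
qed

section \<open>Mollification in the weighted space\<close>

text \<open>The radius of the mollifier meets two independent demands: the modulus of continuity of
  \<open>w\<close> gives the norm bound, and the L1 modulus of \<open>v\<close> gives the L2
  bound.\<close>

lemma smooth_approximation:
  fixes v :: "'a \<Rightarrow> complex"
  assumes ti: "translation_invariant \<rho>"
    and w: "continuous_on UNIV w" "\<And>x. w x > 0"
    and v [measurable]: "v \<in> borel_measurable borel"
    and B: "\<And>x. cmod (v x) \<le> B" and R: "\<And>x. norm x > R \<Longrightarrow> v x = 0"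
    and fin: "weighted_norm \<rho> w v < \<infinity>" and e: "e > 0"
  obtains U where "U \<in> C0_infinity" "(\<integral>\<^sup>+x. ennreal (cmod (v x - U x)) ^ 2 \<partial>lebesgue) \<le> ennreal e"
    "weighted_norm \<rho> w U \<le> ennreal (1 + e) * weighted_norm \<rho> w v"
proof -
  have [measurable]: "w \<in> borel_measurable borel"
    using w(1) by (rule borel_measurable_continuous_onI)
  have B0: "B \<ge> 0" using B[of 0] norm_ge_zero order_trans by blast
  \<comment> \<open>Radius at most 1 for the mollifier keeps the support of \<open>U\<close> in
    \<open>?K\<close>. The absolute value makes \<open>?K\<close> nonempty even for negative
    \<open>R\<close>, so that \<open>w\<close> attains its extrema there.\<close>
  let ?K = "cball (0::'a) (\<bar>R\<bar> + 1)"
  have wK: "continuous_on ?K w" using w(1) continuous_on_subset by blast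
  obtain xm where xm: "\<And>x. x \<in> ?K \<Longrightarrow> w xm \<le> w x"
    using continuous_attains_inf[OF compact_cball _ wK] by force
  obtain xM where xM: "\<And>x. x \<in> ?K \<Longrightarrow> w x \<le> w xM"
    using continuous_attains_sup[OF compact_cball _ wK] by force
  \<comment> \<open>As \<open>w xm\<close> is the minimum on \<open>?K\<close>, an oscillation below
    \<open>e * w xm\<close> is below \<open>e * w (x - y)\<close>: the additive bound becomes the
    multiplicative factor \<open>1 + e\<close>.\<close>
  have "e * w xm > 0" using e w by simp
  with compact_uniformly_continuous[OF wK compact_cball] obtain d where d: "d > 0"
    "\<And>x y. x \<in> ?K \<Longrightarrow> y \<in> ?K \<Longrightarrow> dist y x < d \<Longrightarrow> dist (w y) (w x) < e * w xm"
    unfolding uniformly_continuous_on_def by metis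
  \<comment> \<open>Passing from L1 to L2 costs the factor \<open>2 * B\<close>; the added 1 allows
    \<open>B = 0\<close>.\<close>
  define e' where "e' = e / (2 * B + 1)"
  have e': "e' > 0" "2 * B * e' \<le> e" using e B0 by (auto simp: e'_def field_simps)
  define \<omega> where "\<omega> = (\<lambda>z. (\<integral>x. norm (v (x - z) - v x) \<partial>lborel))"
  have "((\<lambda>z. \<integral>x. norm (v (x - z) - v x) \<partial>lborel) \<longlongrightarrow> 0) (at 0)"
    by (rule translation_L1_continuous[OF v B R])
  then have "(\<omega> \<longlongrightarrow> 0) (at 0)" by (simp add: \<omega>_def)
  from order_tendstoD(2)[OF this e'(1)] obtain d' where
    d': "d' > 0" "\<And>z. z \<noteq> 0 \<Longrightarrow> norm z < d' \<Longrightarrow> \<omega> z < e'"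
    by (auto simp: eventually_at)
  have \<omega>: "\<omega> z \<le> e'" if "norm z < d'" for z
    using d'(2)[OF _ that] e'(1) by (cases "z = 0") (auto simp: \<omega>_def)
  define r where "r = min 1 (min d d')"
  have r: "r > 0" "r \<le> 1" "r \<le> d" "r \<le> d'" using d d' by (auto simp: r_def)
  obtain \<phi> :: "'a \<Rightarrow> real" where \<phi>: "smooth_fun (\<lambda>x. complex_of_real (\<phi> x))" "\<And>x. \<phi> x \<ge> 0"
    "\<And>x. norm x \<ge> r \<Longrightarrow> \<phi> x = 0" "integrable lborel \<phi>" "(\<integral>x. \<phi> x \<partial>lborel) = 1"
    using mollifier_exists[OF r(1)] by blast
  have [measurable]: "\<phi> \<in> borel_measurable borel" using \<phi> by auto
  have iv: "integrable lborel v" by (rule integrable_bounded_support[OF v B R])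
  \<comment> \<open>Here the translate sits on \<open>\<phi>\<close>, which suits smoothness;
    \<open>U_eq\<close> moves it to \<open>v\<close>, which suits the norm estimates.\<close>
  define U where "U x = (\<integral>y. v y * of_real (\<phi> (x - y)) \<partial>lborel)" for x
  have U_eq: "U x = (\<integral>y. \<phi> y *\<^sub>R v (x - y) \<partial>lborel)" for x
    using integral_lborel_reflect[of "\<lambda>y. v y * of_real (\<phi> (x - y))" x]
    by (simp add: U_def scaleR_conv_of_real mult.commute)
  have iU: "integrable lborel (\<lambda>y. \<phi> y *\<^sub>R v (x - y))" for x
  proof (rule Bochner_Integration.integrable_bound[where f = "\<lambda>y. \<phi> y * B"])
    show "AE y in lborel. norm (\<phi> y *\<^sub>R v (x - y)) \<le> norm (\<phi> y * B)"
      using B0 by (intro AE_I2) (auto simp: abs_mult intro!: mult_left_mono B)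
  qed (use \<phi> in auto)
  have smooth: "smooth_fun U"
    unfolding U_def by (rule smooth_fun_convolution[OF \<phi>(1) iv R])
  have [measurable]: "U \<in> borel_measurable borel"
    using smooth_fun_continuous_on[OF smooth] by (rule borel_measurable_continuous_onI)
  have supp: "v (x - y) = 0 \<or> \<phi> y = 0" if "norm x > \<bar>R\<bar> + 1" for x y
  proof (cases "norm y \<ge> r")
    case False
    have "norm x \<le> norm (x - y) + norm y" using norm_triangle_sub[of x y] by simp
    with False that r show ?thesis by (intro disjI1 R) auto
  qed (use \<phi> in auto)
  have U0: "U x = 0" if "norm x > \<bar>R\<bar> + 1" for x
  proof -
    have "(\<lambda>y. \<phi> y *\<^sub>R v (x - y)) = (\<lambda>y. 0)" using supp[OF that] by (auto simp: fun_eq_iff)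
    then show ?thesis unfolding U_eq by simp
  qed
  have "{x. U x \<noteq> 0} \<subseteq> ?K" using U0 by (force simp: not_less)
  then have "bounded {x. U x \<noteq> 0}" using bounded_cball bounded_subset by blast
  then have C0: "U \<in> C0_infinity" using smooth by (simp add: C0_infinity_def)
  have UB: "cmod (U x) \<le> B" for x
  proof -
    have "cmod (U x) \<le> (\<integral>y. norm (\<phi> y *\<^sub>R v (x - y)) \<partial>lborel)"
      unfolding U_eq by (rule integral_norm_bound)
    also have "\<dots> \<le> (\<integral>y. \<phi> y * B \<partial>lborel)"
      using \<phi> iU by (intro integral_mono integrable_norm) (auto intro!: mult_left_mono B)
    also have "\<dots> = B" by (simp add: \<phi>)
    finally show ?thesis .
  qed
  have "(\<integral>\<^sup>+x. ennreal (cmod (U x - v x)) \<partial>lborel) \<le> (\<integral>\<^sup>+y. ennreal (\<phi> y * \<omega> y) \<partial>lborel)"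
  proof -
    \<comment> \<open>Total mass 1 presents \<open>v x\<close> as the average with zero
      displacement.\<close>
    have "v x = (\<integral>y. \<phi> y *\<^sub>R v (x - 0) \<partial>lborel)" for x by (simp add: \<phi>)
    moreover have "(\<integral>\<^sup>+x. ennreal (cmod (U x - (\<integral>y. \<phi> y *\<^sub>R v (x - 0) \<partial>lborel))) \<partial>lborel) \<le>
        (\<integral>\<^sup>+y. ennreal (\<phi> y * \<omega> (y - 0)) \<partial>lborel)"
      unfolding U_eq \<omega>_def by (rule convolution_L1_difference[OF v B R \<phi>(4,2)]) measurable
    ultimately show ?thesis by simp
  qed
  also have "\<dots> \<le> (\<integral>\<^sup>+y. ennreal (\<phi> y * e') \<partial>lborel)"
  proof (intro nn_integral_mono ennreal_leI)
    fix y show "\<phi> y * \<omega> y \<le> \<phi> y * e'"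
      using \<phi>(2,3)[of y] \<omega>[of y] r by (cases "norm y \<ge> r") (auto intro!: mult_left_mono)
  qed
  also have "\<dots> = ennreal e'"
    using \<phi> e' by (subst nn_integral_eq_integral) auto
  finally have L1: "(\<integral>\<^sup>+x. ennreal (cmod (U x - v x)) \<partial>lborel) \<le> ennreal e'" .
  have "(\<integral>\<^sup>+x. ennreal (cmod (v x - U x)) ^ 2 \<partial>lebesgue) \<le>
      (\<integral>\<^sup>+x. ennreal (2 * B) * ennreal (cmod (U x - v x)) \<partial>lborel)"
    unfolding nn_integral_completion
  proof (rule nn_integral_mono)
    fix x
    have "cmod (U x - v x) \<le> 2 * B"
      using norm_triangle_ineq4[of "U x" "v x"] UB[of x] B[of x] by simp
    then have "cmod (U x - v x) * cmod (U x - v x) \<le> 2 * B * cmod (U x - v x)"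
      by (intro mult_right_mono) auto
    then show "ennreal (cmod (v x - U x)) ^ 2 \<le> ennreal (2 * B) * ennreal (cmod (U x - v x))"
      using B0 by (simp add: power2_eq_square norm_minus_commute ennreal_leI flip: ennreal_mult)
  qed
  also have "\<dots> = ennreal (2 * B) * (\<integral>\<^sup>+x. ennreal (cmod (U x - v x)) \<partial>lborel)"
    by (rule nn_integral_cmult) measurable
  also have "\<dots> \<le> ennreal (2 * B) * ennreal e'" by (intro mult_left_mono L1) auto
  also have "\<dots> \<le> ennreal e" using e' B0 by (simp add: ennreal_leI flip: ennreal_mult)
  finally have L2: "(\<integral>\<^sup>+x. ennreal (cmod (v x - U x)) ^ 2 \<partial>lebesgue) \<le> ennreal e" .
  define g where "g x = cmod (v x) * w x" for x
  have [measurable]: "g \<in> borel_measurable borel" unfolding g_def by measurable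
  have g0: "g x \<ge> 0" for x using w(2)[of x] by (simp add: g_def)
  have gR: "g x = 0" if "norm x > R" for x using R[OF that] by (simp add: g_def)
  have gB: "g x \<le> B * w xM" for x
  proof (cases "norm x > R")
    case True
    then show ?thesis using B0 w(2)[of xM] by (simp add: gR)
  next
    case False
    then show ?thesis unfolding g_def using B0 B w(2)[of x] by (intro mult_mono xM) auto
  qed
  have norm_eq: "weighted_norm \<rho> w f = \<rho> (\<lambda>x. ennreal (cmod (f x) * w x))" for f
    using w(2) by (simp add: weighted_norm_def bfs_norm_def norm_mult less_imp_le)
  have gv: "weighted_norm \<rho> w v = \<rho> (\<lambda>x. ennreal (g x))" by (simp add: norm_eq g_def)
  define G where "G x = (\<integral>y. \<phi> y * g (x - y) \<partial>lborel)" for x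
  have [measurable]: "G \<in> borel_measurable borel" unfolding G_def by measurable
  have G_le: "\<rho> (\<lambda>x. ennreal (G x)) \<le> \<rho> (\<lambda>x. ennreal (g x))"
    unfolding G_def
    by (rule rho_convolution_le[OF ti _ g0 gB gR]) (use fin \<phi> in \<open>auto simp: gv\<close>)
  have iG: "integrable lborel (\<lambda>y. \<phi> y * g (x - y))" for x
  proof (rule Bochner_Integration.integrable_bound[where f = "\<lambda>y. \<phi> y * (B * w xM)"])
    show "AE y in lborel. norm (\<phi> y * g (x - y)) \<le> norm (\<phi> y * (B * w xM))"
    proof (rule AE_I2)
      fix y show "norm (\<phi> y * g (x - y)) \<le> norm (\<phi> y * (B * w xM))"
        using mult_left_mono[OF order_trans[OF gB abs_ge_self], of "\<phi> y" "x - y"] \<phi>(2)[of y] g0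
        by (simp add: abs_mult)
    qed
  qed (use \<phi> in auto)
  \<comment> \<open>Outside \<open>?K\<close> the left side vanishes. Inside, only those
    \<open>y\<close> matter for which \<open>\<phi> y\<close> and \<open>v (x - y)\<close> can both
    be nonzero; then \<open>x - y\<close> lies in \<open>?K\<close> too and the two weights are
    comparable.\<close>
  have UG: "cmod (U x) * w x \<le> (1 + e) * G x" for x
  proof (cases "norm x > \<bar>R\<bar> + 1")
    case True
    have "G x \<ge> 0" unfolding G_def using \<phi> g0 by (intro integral_nonneg_AE) auto
    with True show ?thesis using e by (simp add: U0)
  next
    case False
    have "cmod (U x) * w x \<le> (\<integral>y. norm (\<phi> y *\<^sub>R v (x - y)) \<partial>lborel) * w x"
      unfolding U_eq using w(2)[of x] by (intro mult_right_mono integral_norm_bound) auto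
    also have "\<dots> = (\<integral>y. norm (\<phi> y *\<^sub>R v (x - y)) * w x \<partial>lborel)" by simp
    also have "\<dots> \<le> (\<integral>y. (1 + e) * (\<phi> y * g (x - y)) \<partial>lborel)"
    proof (rule integral_mono)
      show "integrable lborel (\<lambda>y. norm (\<phi> y *\<^sub>R v (x - y)) * w x)"
        by (intro integrable_mult_left integrable_norm iU)
      show "integrable lborel (\<lambda>y. (1 + e) * (\<phi> y * g (x - y)))"
        by (intro integrable_mult_right iG)
      fix y
      show "norm (\<phi> y *\<^sub>R v (x - y)) * w x \<le> (1 + e) * (\<phi> y * g (x - y))"
      proof (cases "norm y \<ge> r \<or> norm (x - y) > R")
        case True
        then show ?thesis using \<phi>(3)[of y] R[of "x - y"] gR[of "x - y"] by auto
      next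
        case nt: False
        have K: "x \<in> ?K" "x - y \<in> ?K" using False nt by auto
        have "dist (w x) (w (x - y)) < e * w xm"
          by (rule d(2)[OF K(2,1)]) (use nt r in \<open>auto simp: dist_norm\<close>)
        also have "\<dots> \<le> e * w (x - y)" using e by (intro mult_left_mono xm K) auto
        finally have "w x \<le> (1 + e) * w (x - y)" by (simp add: dist_real_def algebra_simps)
        then have "\<phi> y * cmod (v (x - y)) * w x \<le> \<phi> y * cmod (v (x - y)) * ((1 + e) * w (x - y))"
          using \<phi>(2) by (intro mult_left_mono) auto
        then show ?thesis using \<phi>(2)[of y] by (simp add: g_def algebra_simps)
      qed
    qed
    also have "\<dots> = (1 + e) * G x" by (simp add: G_def)
    finally show ?thesis .
  qed
  have "weighted_norm \<rho> w U \<le> \<rho> (\<lambda>x. ennreal (1 + e) * ennreal (G x))"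
    unfolding norm_eq
  proof (rule rho_mono)
    show "AE x in lebesgue. ennreal (cmod (U x) * w x) \<le> ennreal (1 + e) * ennreal (G x)"
    proof (rule AE_I2)
      fix x
      have "ennreal (1 + e) * ennreal (G x) = ennreal ((1 + e) * G x)"
        using e by (subst ennreal_mult') auto
      with ennreal_leI[OF UG] show "ennreal (cmod (U x) * w x) \<le> ennreal (1 + e) * ennreal (G x)"
        by simp
    qed
  qed (auto intro!: measurable_completion)
  also have "\<dots> = ennreal (1 + e) * \<rho> (\<lambda>x. ennreal (G x))"
    using e by (intro rho_cmult measurable_completion) auto
  also have "\<dots> \<le> ennreal (1 + e) * weighted_norm \<rho> w v"
    unfolding gv by (intro mult_left_mono G_le) auto
  finally show thesis using that[OF C0 L2] by blast
qed

end

section \<open>Truncation and the approximating sequence\<close>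

lemma borel_representative:
  fixes u :: "'a::euclidean_space \<Rightarrow> complex"
  assumes "u \<in> borel_measurable lebesgue"
  obtains u' where "u' \<in> borel_measurable borel" "AE x in lebesgue. u x = u' x"
proof -
  have "(\<lambda>x. Re (u x)) \<in> borel_measurable lebesgue" "(\<lambda>x. Im (u x)) \<in> borel_measurable lebesgue"
    using assms by measurable
  then obtain a b where ab: "a \<in> borel_measurable lborel" "b \<in> borel_measurable lborel"
    "AE x in lborel. Re (u x) = a x" "AE x in lborel. Im (u x) = b x"
    using completion_ex_borel_measurable_real by metis
  show thesis
  proof (rule that[of "\<lambda>x. Complex (a x) (b x)"])
    have "(\<lambda>x. complex_of_real (a x) + \<i> * complex_of_real (b x)) \<in> borel_measurable borel"
      using ab by simp
    then show "(\<lambda>x. Complex (a x) (b x)) \<in> borel_measurable borel" by (simp add: Complex_eq)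
    show "AE x in lebesgue. u x = Complex (a x) (b x)"
      by (rule AE_completion) (use ab(3,4) in eventually_elim, auto simp: complex_eq_iff)
  qed
qed

theorem theorem2p4:
  fixes \<rho> :: "('a::euclidean_space \<Rightarrow> ennreal) \<Rightarrow> ennreal"
    and w :: "'a \<Rightarrow> real"
  assumes "banach_function_norm \<rho>"
    and "translation_invariant \<rho>"
    and "continuous_on UNIV w"
    and "\<forall>x. w x > 0"
  shows "bounded_L2_approx (weighted_space \<rho> w) (weighted_norm \<rho> w)"
proof -
  interpret bfn \<rho> by standard fact
  have [measurable]: "w \<in> borel_measurable borel"
    using assms(3) by (rule borel_measurable_continuous_onI)
  show ?thesis
    unfolding bounded_L2_approx_def
  proof
    fix u assume u: "u \<in> L2_space \<inter> weighted_space \<rho> w"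
    then have um: "u \<in> borel_measurable lebesgue" and
      uL2: "(\<integral>\<^sup>+ x. ennreal (cmod (u x)) ^ 2 \<partial>lebesgue) < \<infinity>" and
      ufin: "weighted_norm \<rho> w u < \<infinity>"
      by (auto simp: L2_space_def weighted_space_def bfs_space_def weighted_norm_def bfs_norm_def)
    obtain u' where u' [measurable]: "u' \<in> borel_measurable borel" and ae: "AE x in lebesgue. u x = u' x"
      using borel_representative[OF um] .
    \<comment> \<open>Each value is either kept or set to 0, so monotonicity bounds the norm by that
      of \<open>u\<close>; at every point the value is kept from some \<open>n\<close> on.\<close>
    define v where "v n x = (if norm x \<le> real n \<and> cmod (u' x) \<le> real n then u' x else 0)" for n x
    have vm [measurable]: "v n \<in> borel_measurable borel" for n unfolding v_def by measurable
    have v_le: "weighted_norm \<rho> w (v n) \<le> weighted_norm \<rho> w u" for n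
      unfolding weighted_norm_def bfs_norm_def
    proof (rule rho_mono)
      have "w \<in> borel_measurable lebesgue" by (rule measurable_completion) simp
      with um show "(\<lambda>x. ennreal (cmod (u x * complex_of_real (w x)))) \<in> borel_measurable lebesgue"
        by measurable
      show "(\<lambda>x. ennreal (cmod (v n x * complex_of_real (w x)))) \<in> borel_measurable lebesgue"
        by (rule measurable_completion) simp
      show "AE x in lebesgue. ennreal (cmod (v n x * complex_of_real (w x))) \<le> ennreal (cmod (u x * complex_of_real (w x)))"
        using ae by eventually_elim (auto simp: v_def intro!: ennreal_leI)
    qed
    define P where "P n f \<longleftrightarrow> f \<in> C0_infinity \<and>
        (\<integral>\<^sup>+x. ennreal (cmod (v n x - f x)) ^ 2 \<partial>lebesgue) \<le> ennreal (1 / real (Suc n)) \<and>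
        weighted_norm \<rho> w f \<le> ennreal (1 + 1 / real (Suc n)) * weighted_norm \<rho> w (v n)" for n f
    have "\<exists>f. P n f" for n
    proof -
      have fin: "weighted_norm \<rho> w (v n) < \<infinity>" using v_le[of n] ufin by (rule le_less_trans)
      show ?thesis
      proof (rule smooth_approximation[OF assms(2,3) _ vm _ _ fin, where B = "real n" and R = "real n" and e = "1 / real (Suc n)"])
        show "w x > 0" for x using assms(4) by blast
        show "cmod (v n x) \<le> real n" "norm x > real n \<Longrightarrow> v n x = 0" for x
          by (auto simp: v_def)
      qed (auto simp: P_def)
    qed
    then obtain U where PU: "\<And>n. P n (U n)" by metis
    have U: "U n \<in> C0_infinity"
      "(\<integral>\<^sup>+x. ennreal (cmod (v n x - U n x)) ^ 2 \<partial>lebesgue) \<le> ennreal (1 / real (Suc n))"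
      "weighted_norm \<rho> w (U n) \<le> ennreal (1 + 1 / real (Suc n)) * weighted_norm \<rho> w (v n)" for n
      using PU[of n] unfolding P_def by blast+
    show "\<exists>U. (\<forall>j. U j \<in> C0_infinity) \<and>
        (\<lambda>j. \<integral>\<^sup>+ x. ennreal (cmod (u x - U j x)) ^ 2 \<partial>lebesgue) \<longlonglongrightarrow> 0 \<and>
        limsup (\<lambda>j. weighted_norm \<rho> w (U j)) \<le> weighted_norm \<rho> w u"
    proof (intro exI[of _ U] conjI allI U(1))
      have Um [measurable]: "U j \<in> borel_measurable borel" for j
        using U(1)[of j] smooth_fun_continuous_on[of "U j" UNIV]
        by (auto simp: C0_infinity_def intro: borel_measurable_continuous_onI)
      have "(\<integral>\<^sup>+ x. ennreal ((cmod (u' x))\<^sup>2) \<partial>lebesgue) < \<infinity>"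
      proof -
        have "(\<integral>\<^sup>+ x. ennreal ((cmod (u' x))\<^sup>2) \<partial>lebesgue) = (\<integral>\<^sup>+ x. ennreal (cmod (u x)) ^ 2 \<partial>lebesgue)"
          using ae by (intro nn_integral_cong_AE) (auto simp: ennreal_power elim!: eventually_mono)
        then show ?thesis using uL2 by simp
      qed
      then have fin: "(\<integral>\<^sup>+ x. ennreal ((cmod (u' x))\<^sup>2) \<partial>lborel) < \<infinity>"
        by (simp add: nn_integral_completion)
      \<comment> \<open>The difference is 0 or \<open>u' x\<close>, so the integrable function
        \<open>|u'|^2\<close> dominates.\<close>
      have "(\<lambda>n. \<integral>\<^sup>+ x. ennreal ((cmod (u' x - v n x))\<^sup>2) \<partial>lborel) \<longlonglongrightarrow> (\<integral>\<^sup>+ x. 0 \<partial>(lborel :: 'a measure))"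
      proof (rule nn_integral_dominated_convergence[OF _ _ _ _ fin])
        show "AE x in lborel. ennreal ((cmod (u' x - v n x))\<^sup>2) \<le> ennreal ((cmod (u' x))\<^sup>2)" for n
          by (intro AE_I2 ennreal_leI) (auto simp: v_def)
        show "AE x in lborel. (\<lambda>n. ennreal ((cmod (u' x - v n x))\<^sup>2)) \<longlonglongrightarrow> 0"
        proof (rule AE_I2)
          fix x
          obtain N where N: "max (norm x) (cmod (u' x)) \<le> real N" using real_arch_simple by blast
          have "eventually (\<lambda>n. ennreal ((cmod (u' x - v n x))\<^sup>2) = 0) sequentially"
            using eventually_ge_at_top[of N]
          proof eventually_elim
            case (elim n)
            with N have "max (norm x) (cmod (u' x)) \<le> real n" by linarith
            then show ?case by (simp add: v_def)
          qed
          then show "(\<lambda>n. ennreal ((cmod (u' x - v n x))\<^sup>2)) \<longlonglongrightarrow> 0" by (rule tendsto_eventually)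
        qed
      qed auto
      then have trunc: "(\<lambda>n. \<integral>\<^sup>+ x. ennreal ((cmod (u' x - v n x))\<^sup>2) \<partial>lborel) \<longlonglongrightarrow> 0" by simp
      \<comment> \<open>Convergence is stated for squared norms, so the inequality
        \<open>(a + b)^2 \<le> 2 * a^2 + 2 * b^2\<close> replaces the triangle inequality in
        L2.\<close>
      have bound: "(\<integral>\<^sup>+ x. ennreal (cmod (u x - U n x)) ^ 2 \<partial>lebesgue) \<le>
          2 * (\<integral>\<^sup>+ x. ennreal ((cmod (u' x - v n x))\<^sup>2) \<partial>lborel) + 2 * ennreal (1 / real (Suc n))" for n
      proof -
        have "(\<integral>\<^sup>+ x. ennreal (cmod (u x - U n x)) ^ 2 \<partial>lebesgue) =
            (\<integral>\<^sup>+ x. ennreal (cmod (u' x - U n x)) ^ 2 \<partial>lebesgue)"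
          using ae by (intro nn_integral_cong_AE) (auto elim!: eventually_mono)
        also have "\<dots> \<le> (\<integral>\<^sup>+ x. 2 * ennreal ((cmod (u' x - v n x))\<^sup>2) + 2 * ennreal ((cmod (v n x - U n x))\<^sup>2) \<partial>lborel)"
          unfolding nn_integral_completion
        proof (rule nn_integral_mono)
          fix x
          let ?a = "cmod (u' x - v n x)" and ?b = "cmod (v n x - U n x)"
          have "cmod (u' x - U n x) \<le> ?a + ?b"
            using norm_triangle_ineq[of "u' x - v n x" "v n x - U n x"] by simp
          then have "(cmod (u' x - U n x))\<^sup>2 \<le> (?a + ?b)\<^sup>2" by (intro power_mono) auto
          also have "\<dots> \<le> 2 * ?a\<^sup>2 + 2 * ?b\<^sup>2"
            using sum_squares_bound[of ?a ?b] by (simp add: power2_sum)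
          finally have "ennreal ((cmod (u' x - U n x))\<^sup>2) \<le> ennreal (2 * ?a\<^sup>2 + 2 * ?b\<^sup>2)"
            by (rule ennreal_leI)
          then show "ennreal (cmod (u' x - U n x)) ^ 2 \<le> 2 * ennreal (?a\<^sup>2) + 2 * ennreal (?b\<^sup>2)"
            by (simp add: ennreal_power ennreal_plus ennreal_mult)
        qed
        also have "\<dots> = 2 * (\<integral>\<^sup>+ x. ennreal ((cmod (u' x - v n x))\<^sup>2) \<partial>lborel) +
            2 * (\<integral>\<^sup>+ x. ennreal ((cmod (v n x - U n x))\<^sup>2) \<partial>lborel)"
          by (simp add: nn_integral_add nn_integral_cmult)
        also have "(\<integral>\<^sup>+ x. ennreal ((cmod (v n x - U n x))\<^sup>2) \<partial>lborel) \<le> ennreal (1 / real (Suc n))"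
          using U(2)[of n] by (simp add: ennreal_power nn_integral_completion)
        finally show ?thesis by (simp add: add_left_mono mult_left_mono)
      qed
      have "(\<lambda>n. 2 * (\<integral>\<^sup>+ x. ennreal ((cmod (u' x - v n x))\<^sup>2) \<partial>lborel) + 2 * ennreal (1 / real (Suc n)))
          \<longlonglongrightarrow> 2 * 0 + 2 * ennreal 0"
        by (intro tendsto_add ennreal_tendsto_cmult trunc tendsto_ennrealI lim_1_over_n[THEN LIMSEQ_Suc]) auto
      then have "(\<lambda>n. 2 * (\<integral>\<^sup>+ x. ennreal ((cmod (u' x - v n x))\<^sup>2) \<partial>lborel) + 2 * ennreal (1 / real (Suc n)))
          \<longlonglongrightarrow> 0" by simp
      then show "(\<lambda>j. \<integral>\<^sup>+ x. ennreal (cmod (u x - U j x)) ^ 2 \<partial>lebesgue) \<longlonglongrightarrow> 0"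
        by (rule tendsto_sandwich[OF _ _ tendsto_const, rotated 2]; intro always_eventually allI)
           (rule bound | simp)+
      \<comment> \<open>The norm of \<open>u\<close> is finite, so the limit of the upper bounds can
        be taken in the reals.\<close>
      obtain m where m: "m \<ge> 0" "weighted_norm \<rho> w u = ennreal m"
        using ufin by (cases "weighted_norm \<rho> w u") auto
      have "weighted_norm \<rho> w (U n) \<le> ennreal ((1 + 1 / real (Suc n)) * m)" for n
      proof -
        have "weighted_norm \<rho> w (U n) \<le> ennreal (1 + 1 / real (Suc n)) * weighted_norm \<rho> w u"
          by (rule order_trans[OF U(3)]) (intro mult_left_mono v_le, simp)
        then show ?thesis using m by (simp add: ennreal_mult')
      qed
      then have "limsup (\<lambda>j. weighted_norm \<rho> w (U j)) \<le> limsup (\<lambda>n. ennreal ((1 + 1 / real (Suc n)) * m))"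
        by (intro Limsup_mono always_eventually) auto
      also have "(\<lambda>n. ennreal ((1 + 1 / real (Suc n)) * m)) \<longlonglongrightarrow> ennreal ((1 + 0) * m)"
        by (intro tendsto_ennrealI tendsto_mult tendsto_add tendsto_const lim_1_over_n[THEN LIMSEQ_Suc])
      then have "limsup (\<lambda>n. ennreal ((1 + 1 / real (Suc n)) * m)) = ennreal m"
        by (intro lim_imp_Limsup) auto
      finally show "limsup (\<lambda>j. weighted_norm \<rho> w (U j)) \<le> weighted_norm \<rho> w u" by (simp add: m)
    qed
  qed
qed

end
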